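(* Let $N$ be a normal subgroup of a group $G$ with a nontrivial amalgamated product decomposition $G = A \ast_C B$. (1) If $N$ is finitely generated and $N \not\subseteq C$, then $NC$ is of finite index in $G$; and if moreover $N \cap C$ is finitely generated, then $N \cap A$ and $N \cap B$ are finitely generated. (2) Conversely, if $NC$ is of finite index in $G$, then $N \not\subseteq C$; and if moreover $N \cap A$ and $N \cap B$ are finitely generated, then $N$ is finitely generated. (3) If $NC$ is of finite index in $G$, then $G/N$ is finite if and only if $C/(N \cap C)$ is finite.
   Context: $G = A\ast_C B$ denotes the amalgamated product of groups $A$ and $B$ along a common subgroup $C$, where $A$, $B$ and $C$ are regarded as subgroups of $G$. The amalgamated product $A \ast_C B$ is called nontrivial if and only if $A \neq C \neq B$ (i.e. $C \ne A$ and $C \ne B$). *)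

theory Defs
  imports "HOL-Algebra.Coset" "HOL-Algebra.Generated_Groups"
begin

section \<open>Finite generation and finite index\<close>

definition finitely_generated_subgroup :: "('a, 'm) monoid_scheme \<Rightarrow> 'a set \<Rightarrow> bool" where
  "finitely_generated_subgroup G H \<longleftrightarrow>
     subgroup H G \<and> (\<exists>S. finite S \<and> S \<subseteq> H \<and> generate G S = H)"

definition finite_index :: "('a, 'm) monoid_scheme \<Rightarrow> 'a set \<Rightarrow> bool" where
  "finite_index G H \<longleftrightarrow> subgroup H G \<and> finite (rcosets\<^bsub>G\<^esub> H)"

section \<open>The amalgamated product (pushout) of two groups\<close>

text \<open>
  For homomorphisms \<open>f : C \<rightarrow> A\<close> and \<open>g : C \<rightarrow> B\<close>, the amalgamated product is the set of words
  with letters in the disjoint union of \<open>A\<close> and \<open>B\<close>, modulo the congruence generated by the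
  multiplication tables of \<open>A\<close> and \<open>B\<close> and by the identification of \<open>f c\<close> with \<open>g c\<close>.
  It is the pushout of \<open>f\<close> and \<open>g\<close>, by the lemmas \<open>amalg_lift_hom\<close>, \<open>amalg_lift_inl\<close>,
  \<open>amalg_lift_inr\<close> and \<open>amalg_lift_unique\<close> below.
\<close>

abbreviation amalg_words ::
  "('a, 'm) monoid_scheme \<Rightarrow> ('b, 'n) monoid_scheme \<Rightarrow> ('a + 'b) list set" where
  "amalg_words A B \<equiv> lists (carrier A <+> carrier B)"

inductive_set amalg_rel ::
  "('a, 'm) monoid_scheme \<Rightarrow> ('b, 'n) monoid_scheme \<Rightarrow> ('c, 'k) monoid_scheme \<Rightarrow>
   ('c \<Rightarrow> 'a) \<Rightarrow> ('c \<Rightarrow> 'b) \<Rightarrow> (('a + 'b) list \<times> ('a + 'b) list) set"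
  for A B C f g where
  refl: "w \<in> amalg_words A B \<Longrightarrow> (w, w) \<in> amalg_rel A B C f g"
| sym: "(v, w) \<in> amalg_rel A B C f g \<Longrightarrow> (w, v) \<in> amalg_rel A B C f g"
| trans: "(u, v) \<in> amalg_rel A B C f g \<Longrightarrow> (v, w) \<in> amalg_rel A B C f g
    \<Longrightarrow> (u, w) \<in> amalg_rel A B C f g"
| append: "(u, u') \<in> amalg_rel A B C f g \<Longrightarrow> (v, v') \<in> amalg_rel A B C f g
    \<Longrightarrow> (u @ v, u' @ v') \<in> amalg_rel A B C f g"
| one_left: "([Inl \<one>\<^bsub>A\<^esub>], []) \<in> amalg_rel A B C f g"
| one_right: "([Inr \<one>\<^bsub>B\<^esub>], []) \<in> amalg_rel A B C f g"
| mult_left: "x \<in> carrier A \<Longrightarrow> y \<in> carrier A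
    \<Longrightarrow> ([Inl x, Inl y], [Inl (x \<otimes>\<^bsub>A\<^esub> y)]) \<in> amalg_rel A B C f g"
| mult_right: "x \<in> carrier B \<Longrightarrow> y \<in> carrier B
    \<Longrightarrow> ([Inr x, Inr y], [Inr (x \<otimes>\<^bsub>B\<^esub> y)]) \<in> amalg_rel A B C f g"
| amalg: "c \<in> carrier C \<Longrightarrow> ([Inl (f c)], [Inr (g c)]) \<in> amalg_rel A B C f g"

definition amalg_product ::
  "('a, 'm) monoid_scheme \<Rightarrow> ('b, 'n) monoid_scheme \<Rightarrow> ('c, 'k) monoid_scheme \<Rightarrow>
   ('c \<Rightarrow> 'a) \<Rightarrow> ('c \<Rightarrow> 'b) \<Rightarrow> ('a + 'b) list set monoid" where
  "amalg_product A B C f g =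
     \<lparr>carrier = amalg_words A B // amalg_rel A B C f g,
      mult = (\<lambda>X Y. \<Union>u\<in>X. \<Union>v\<in>Y. amalg_rel A B C f g `` {u @ v}),
      one = amalg_rel A B C f g `` {[]}\<rparr>"

primrec amalg_eval ::
  "('d, 'l) monoid_scheme \<Rightarrow> ('a \<Rightarrow> 'd) \<Rightarrow> ('b \<Rightarrow> 'd) \<Rightarrow> ('a + 'b) list \<Rightarrow> 'd" where
  "amalg_eval H h k [] = \<one>\<^bsub>H\<^esub>"
| "amalg_eval H h k (x # w) = case_sum h k x \<otimes>\<^bsub>H\<^esub> amalg_eval H h k w"

text \<open>
  The homomorphism out of the amalgamated product induced by \<open>h : A \<rightarrow> H\<close> and \<open>k : B \<rightarrow> H\<close>
  with \<open>h \<circ> f = k \<circ> g\<close>; then \<open>amalg_eval H h k\<close> is constant on each class (\<open>amalg_lift_class\<close>).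
\<close>

definition amalg_lift ::
  "('d, 'l) monoid_scheme \<Rightarrow> ('a \<Rightarrow> 'd) \<Rightarrow> ('b \<Rightarrow> 'd) \<Rightarrow> ('a + 'b) list set \<Rightarrow> 'd" where
  "amalg_lift H h k X = the_elem (amalg_eval H h k ` X)"

text \<open>
  \<open>G = A *\<^sub>C B\<close> for subgroups: the inclusions of \<open>A\<close> and \<open>B\<close> into \<open>G\<close> induce an isomorphism from
  the amalgamated product onto \<open>G\<close>.
\<close>

definition is_amalg_decomposition ::
  "('a, 'm) monoid_scheme \<Rightarrow> 'a set \<Rightarrow> 'a set \<Rightarrow> 'a set \<Rightarrow> bool" where
  "is_amalg_decomposition G A B C \<longleftrightarrow>
     subgroup A G \<and> subgroup B G \<and> subgroup C G \<and> C \<subseteq> A \<and> C \<subseteq> B \<and>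
     amalg_lift G (\<lambda>x. x) (\<lambda>x. x) \<in>
       iso (amalg_product (G\<lparr>carrier := A\<rparr>) (G\<lparr>carrier := B\<rparr>) (G\<lparr>carrier := C\<rparr>)
              (\<lambda>x. x) (\<lambda>x. x)) G"

definition is_nontrivial_amalg_decomposition ::
  "('a, 'm) monoid_scheme \<Rightarrow> 'a set \<Rightarrow> 'a set \<Rightarrow> 'a set \<Rightarrow> bool" where
  "is_nontrivial_amalg_decomposition G A B C \<longleftrightarrow>
     is_amalg_decomposition G A B C \<and> A \<noteq> C \<and> C \<noteq> B"

section \<open>Group structure and universal property\<close>

locale amalgam = A: group A + B: group B
  for A :: "('a, 'm) monoid_scheme" and B :: "('b, 'n) monoid_scheme" +
  fixes C :: "('c, 'k) monoid_scheme" and f :: "'c \<Rightarrow> 'a" and g :: "'c \<Rightarrow> 'b"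
  assumes f_closed: "c \<in> carrier C \<Longrightarrow> f c \<in> carrier A"
    and g_closed: "c \<in> carrier C \<Longrightarrow> g c \<in> carrier B"
begin

abbreviation "R \<equiv> amalg_rel A B C f g"
abbreviation "W \<equiv> amalg_words A B"
abbreviation "P \<equiv> amalg_product A B C f g"

lemma amalg_rel_words: "(u, v) \<in> R \<Longrightarrow> u \<in> W \<and> v \<in> W"
  by (induction rule: amalg_rel.induct) (auto simp: f_closed g_closed)

lemma equiv_amalg_rel: "equiv W R"
proof (rule equivI)
  show "R \<subseteq> W \<times> W" using amalg_rel_words by auto
  show "refl_on W R" by (auto simp: refl_on_def intro: amalg_rel.refl)
  show "sym R" by (rule symI) (rule amalg_rel.sym)
  show "trans R" by (rule transI) (rule amalg_rel.trans)
qed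

lemma carrier_amalg: "X \<in> carrier P \<longleftrightarrow> (\<exists>u\<in>W. X = R `` {u})"
  by (auto simp: amalg_product_def quotient_def)

lemma class_closed: "u \<in> W \<Longrightarrow> R `` {u} \<in> carrier P"
  by (auto simp: carrier_amalg)

lemma one_amalg: "\<one>\<^bsub>P\<^esub> = R `` {[]}"
  by (simp add: amalg_product_def)

lemma class_eqI: "(u, v) \<in> R \<Longrightarrow> R `` {u} = R `` {v}"
  by (rule equiv_class_eq[OF equiv_amalg_rel])

lemma mult_class:
  assumes "u \<in> W" "v \<in> W"
  shows "R `` {u} \<otimes>\<^bsub>P\<^esub> R `` {v} = R `` {u @ v}"
proof -
  have "R `` {u' @ v'} = R `` {u @ v}" if "u' \<in> R `` {u}" "v' \<in> R `` {v}" for u' v'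
    using that
    by (intro class_eqI amalg_rel.append) (simp_all add: amalg_rel.sym)
  moreover have "u \<in> R `` {u}" "v \<in> R `` {v}"
    using assms by (simp_all add: amalg_rel.refl)
  ultimately show ?thesis
    unfolding amalg_product_def monoid.simps by blast
qed

lemma letter_inverse:
  assumes "x \<in> carrier A <+> carrier B"
  obtains y where "y \<in> carrier A <+> carrier B" "([y, x], []) \<in> R"
proof (cases x)
  case (Inl a)
  with assms have a: "a \<in> carrier A" by auto
  have "([Inl (inv\<^bsub>A\<^esub> a), Inl a], [Inl \<one>\<^bsub>A\<^esub>]) \<in> R"
    using amalg_rel.mult_left[of "inv\<^bsub>A\<^esub> a" A a] a by simp
  then have "([Inl (inv\<^bsub>A\<^esub> a), Inl a], []) \<in> R"
    by (rule amalg_rel.trans) (rule amalg_rel.one_left)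
  then show ?thesis using that[of "Inl (inv\<^bsub>A\<^esub> a)"] Inl a by auto
next
  case (Inr b)
  with assms have b: "b \<in> carrier B" by auto
  have "([Inr (inv\<^bsub>B\<^esub> b), Inr b], [Inr \<one>\<^bsub>B\<^esub>]) \<in> R"
    using amalg_rel.mult_right[of "inv\<^bsub>B\<^esub> b" B b] b by simp
  then have "([Inr (inv\<^bsub>B\<^esub> b), Inr b], []) \<in> R"
    by (rule amalg_rel.trans) (rule amalg_rel.one_right)
  then show ?thesis using that[of "Inr (inv\<^bsub>B\<^esub> b)"] Inr b by auto
qed

lemma word_inverse: "w \<in> W \<Longrightarrow> \<exists>v\<in>W. (v @ w, []) \<in> R"
proof (induction w)
  case Nil
  then show ?case by (auto intro: amalg_rel.refl)
next
  case (Cons x w)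
  then have x: "x \<in> carrier A <+> carrier B" and w: "w \<in> W" by auto
  obtain v where v: "v \<in> W" "(v @ w, []) \<in> R" using Cons.IH w by auto
  obtain y where y: "y \<in> carrier A <+> carrier B" "([y, x], []) \<in> R"
    using letter_inverse[OF x] by blast
  have "(v @ ([y, x] @ w), v @ ([] @ w)) \<in> R"
    by (intro amalg_rel.append amalg_rel.refl v y w)
  then have "((v @ [y]) @ (x # w), []) \<in> R"
    using amalg_rel.trans[OF _ v(2)] by simp
  moreover have "v @ [y] \<in> W" using v y by auto
  ultimately show ?case by blast
qed

lemma group_amalg: "group P"
proof (rule groupI)
  fix X Y assume "X \<in> carrier P" "Y \<in> carrier P"
  then obtain u v where "u \<in> W" "X = R `` {u}" "v \<in> W" "Y = R `` {v}"
    unfolding carrier_amalg by blast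
  then show "X \<otimes>\<^bsub>P\<^esub> Y \<in> carrier P"
    by (simp add: mult_class class_closed)
next
  show "\<one>\<^bsub>P\<^esub> \<in> carrier P" by (simp add: one_amalg class_closed)
next
  fix X Y Z assume "X \<in> carrier P" "Y \<in> carrier P" "Z \<in> carrier P"
  then obtain u v w where
    "u \<in> W" "X = R `` {u}" "v \<in> W" "Y = R `` {v}" "w \<in> W" "Z = R `` {w}"
    unfolding carrier_amalg by blast
  then show "X \<otimes>\<^bsub>P\<^esub> Y \<otimes>\<^bsub>P\<^esub> Z = X \<otimes>\<^bsub>P\<^esub> (Y \<otimes>\<^bsub>P\<^esub> Z)"
    by (simp add: mult_class)
next
  fix X assume "X \<in> carrier P"
  then obtain u where u: "u \<in> W" "X = R `` {u}"
    unfolding carrier_amalg by blast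
  then show "\<one>\<^bsub>P\<^esub> \<otimes>\<^bsub>P\<^esub> X = X"
    by (simp add: one_amalg mult_class)
  obtain v where v: "v \<in> W" "(v @ u, []) \<in> R" using word_inverse u by blast
  then have "R `` {v} \<otimes>\<^bsub>P\<^esub> X = \<one>\<^bsub>P\<^esub>"
    using u by (simp add: one_amalg mult_class class_eqI)
  then show "\<exists>Y\<in>carrier P. Y \<otimes>\<^bsub>P\<^esub> X = \<one>\<^bsub>P\<^esub>"
    using v class_closed by blast
qed

lemma inl_word: "a \<in> carrier A \<Longrightarrow> [Inl a] \<in> W"
  and inr_word: "b \<in> carrier B \<Longrightarrow> [Inr b] \<in> W"
  by auto

lemma inl_hom: "(\<lambda>a. R `` {[Inl a]}) \<in> hom A P"
proof (rule homI)
  fix x y assume xy: "x \<in> carrier A" "y \<in> carrier A"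
  show "R `` {[Inl x]} \<in> carrier P" using class_closed[OF inl_word] xy by blast
  show "R `` {[Inl (x \<otimes>\<^bsub>A\<^esub> y)]} = R `` {[Inl x]} \<otimes>\<^bsub>P\<^esub> R `` {[Inl y]}"
    using class_eqI[OF amalg_rel.mult_left[OF xy]] mult_class[OF inl_word inl_word] xy by simp
qed

lemma inr_hom: "(\<lambda>b. R `` {[Inr b]}) \<in> hom B P"
proof (rule homI)
  fix x y assume xy: "x \<in> carrier B" "y \<in> carrier B"
  show "R `` {[Inr x]} \<in> carrier P" using class_closed[OF inr_word] xy by blast
  show "R `` {[Inr (x \<otimes>\<^bsub>B\<^esub> y)]} = R `` {[Inr x]} \<otimes>\<^bsub>P\<^esub> R `` {[Inr y]}"
    using class_eqI[OF amalg_rel.mult_right[OF xy]] mult_class[OF inr_word inr_word] xy by simp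
qed

lemma inl_inr_agree: "c \<in> carrier C \<Longrightarrow> R `` {[Inl (f c)]} = R `` {[Inr (g c)]}"
  by (rule class_eqI) (rule amalg_rel.amalg)

context
  fixes H :: "('d, 'l) monoid_scheme" and h k
  assumes H: "group H" and h: "h \<in> hom A H" and k: "k \<in> hom B H"
    and agree: "\<And>c. c \<in> carrier C \<Longrightarrow> h (f c) = k (g c)"
begin

interpretation H: group H by (rule H)

lemma amalg_letter_closed: "x \<in> carrier A <+> carrier B \<Longrightarrow> case_sum h k x \<in> carrier H"
  using h k by (auto simp: hom_def)

lemma amalg_eval_closed: "w \<in> W \<Longrightarrow> amalg_eval H h k w \<in> carrier H"
  by (induction w) (simp_all add: amalg_letter_closed)

lemma amalg_eval_append:
  "v \<in> W \<Longrightarrow> w \<in> W \<Longrightarrow> amalg_eval H h k (v @ w) = amalg_eval H h k v \<otimes>\<^bsub>H\<^esub> amalg_eval H h k w"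
  by (induction v) (simp_all add: amalg_letter_closed amalg_eval_closed H.m_assoc)

lemma amalg_eval_rel: "(v, w) \<in> R \<Longrightarrow> amalg_eval H h k v = amalg_eval H h k w"
proof (induction rule: amalg_rel.induct)
  case (append u u' v v')
  then show ?case using amalg_rel_words by (metis amalg_eval_append)
next
  case one_left
  then show ?case using hom_one[OF h A.is_group H] by simp
next
  case one_right
  then show ?case using hom_one[OF k B.is_group H] by simp
next
  case (mult_left x y)
  then show ?case using h by (auto simp: hom_def Pi_def)
next
  case (mult_right x y)
  then show ?case using k by (auto simp: hom_def Pi_def)
next
  case (amalg c)
  then show ?case by (simp add: agree)
qed auto

lemma amalg_lift_class:
  assumes "w \<in> W"
  shows "amalg_lift H h k (R `` {w}) = amalg_eval H h k w"
proof -
  have "amalg_eval H h k ` (R `` {w}) = {amalg_eval H h k w}"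
    using amalg_eval_rel amalg_rel.refl[OF assms] by fastforce
  then show ?thesis by (simp add: amalg_lift_def)
qed

lemma amalg_lift_hom: "amalg_lift H h k \<in> hom P H"
proof (rule homI)
  fix X assume "X \<in> carrier P"
  then show "amalg_lift H h k X \<in> carrier H"
    unfolding carrier_amalg using amalg_lift_class amalg_eval_closed by fastforce
next
  fix X Y assume "X \<in> carrier P" "Y \<in> carrier P"
  then obtain u v where "u \<in> W" "X = R `` {u}" "v \<in> W" "Y = R `` {v}"
    unfolding carrier_amalg by blast
  then show "amalg_lift H h k (X \<otimes>\<^bsub>P\<^esub> Y) = amalg_lift H h k X \<otimes>\<^bsub>H\<^esub> amalg_lift H h k Y"
    by (simp add: mult_class amalg_lift_class amalg_eval_append)
qed

lemma amalg_lift_inl: "a \<in> carrier A \<Longrightarrow> amalg_lift H h k (R `` {[Inl a]}) = h a"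
  using amalg_lift_class[OF inl_word] hom_in_carrier[OF h] by simp

lemma amalg_lift_inr: "b \<in> carrier B \<Longrightarrow> amalg_lift H h k (R `` {[Inr b]}) = k b"
  using amalg_lift_class[OF inr_word] hom_in_carrier[OF k] by simp

lemma amalg_lift_unique:
  assumes p: "p \<in> hom P H"
    and pl: "\<And>a. a \<in> carrier A \<Longrightarrow> p (R `` {[Inl a]}) = h a"
    and pr: "\<And>b. b \<in> carrier B \<Longrightarrow> p (R `` {[Inr b]}) = k b"
    and X: "X \<in> carrier P"
  shows "p X = amalg_lift H h k X"
proof -
  have "p (R `` {w}) = amalg_eval H h k w" if "w \<in> W" for w
    using that
  proof (induction w)
    case Nil
    then show ?case using hom_one[OF p group_amalg H] by (simp add: one_amalg)
  next
    case (Cons x w)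
    then have x: "[x] \<in> W" and w: "w \<in> W" by auto
    have "p (R `` {x # w}) = p (R `` {[x]} \<otimes>\<^bsub>P\<^esub> R `` {w})"
      using mult_class[OF x w] by simp
    also have "\<dots> = p (R `` {[x]}) \<otimes>\<^bsub>H\<^esub> p (R `` {w})"
      using hom_mult[OF p class_closed[OF x] class_closed[OF w]] .
    also have "p (R `` {[x]}) = case_sum h k x"
      using x pl pr by (auto split: sum.split)
    finally show ?case using Cons.IH w by simp
  qed
  then show ?thesis using X amalg_lift_class unfolding carrier_amalg by fastforce
qed

end

end

end

theory Submission
  imports Defs "HOL-Algebra.Zassenhaus"
begin

text \<open>
  Geometrically, the theorem concerns the action of \<open>N\<close> on the Bass--Serre tree of \<open>A *\<^sub>C B\<close>, whose
  edges are the cosets \<open>g C\<close> and whose vertices are the cosets \<open>g A\<close> and \<open>g B\<close>. The proof does not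
  construct the tree. All that it uses of it is the half-tree \<open>D\<close> on the side of the vertex \<open>B\<close> of
  the base edge \<open>C\<close>: a subset \<open>D\<close> of \<open>G\<close> that contains \<open>C\<close>, is stable under right multiplication by
  \<open>B\<close>, is stable under right multiplication by \<open>A\<close> apart from the base edge, and has the ping-pong
  property that the elements of \<open>A - C\<close> move \<open>D\<close> into its complement and those of \<open>B - C\<close> move the
  complement into \<open>D - C\<close> (locale \<open>amalgam_half_space\<close>). These conditions are symmetric in \<open>A\<close> and
  \<open>B\<close> (\<open>swap\<close>).

  Existence of \<open>D\<close> (\<open>ex_half_space\<close>) comes from the universal property, without normal forms: mapping
  \<open>A\<close> and \<open>B\<close> to the semidirect product of the power set of \<open>G\<close> (under symmetric difference) with \<open>G\<close>
  yields a derivation \<open>d\<close> with \<open>d b = {}\<close> on \<open>B\<close> and \<open>d a\<close> the symmetric difference of \<open>C\<close> and \<open>a C\<close> on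
  \<open>A\<close>. Here \<open>d g\<close> is the set of edges on the path from the vertex \<open>B\<close> to \<open>g B\<close>, and \<open>D\<close> consists of
  those \<open>g\<close> whose path avoids the base edge.

  If \<open>N\<close> is finitely generated, some finite union of double cosets \<open>N y C\<close> is a connected set \<open>X\<close> of
  edges. If \<open>X\<close> is not everything, an edge \<open>x C\<close> outside \<open>X\<close> is adjacent to it, so \<open>X\<close> lies on one side
  of that edge; by normality and ping-pong this forces \<open>N \<subseteq> C\<close> (\<open>subset_C_of_exit\<close>). Hence \<open>N C\<close> has
  finite index (\<open>finite_index_of_finitely_generated\<close>).

  If moreover \<open>N \<inter> C\<close> is finitely generated, split every vertex in the \<open>N\<close>-orbit of the vertex \<open>A\<close>
  into one piece for each coset of a subgroup \<open>U\<close> of \<open>N \<inter> A\<close>. For a suitable finitely generated \<open>U\<close>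
  the edge \<open>C\<close> stays connected to all of its translates by \<open>N\<close>. In a tree, distinct pieces of a vertex
  are never connected, so \<open>U = N \<inter> A\<close> (\<open>finitely_generated_inter_A\<close>).

  Conversely \<open>C\<close> has infinite index by ping-pong (\<open>not_finite_index_C\<close>), so \<open>N \<subseteq> C\<close> is impossible when
  \<open>N C\<close> has finite index. A group acting on a connected graph with finitely many orbits and finitely
  generated vertex stabilizers is finitely generated; for \<open>N\<close> this is a computation with double
  cosets \<open>N t C\<close> (\<open>finitely_generated_of_factors\<close>). The last claim is a count of cosets
  (\<open>finite_quotient_iff\<close>).
\<close>

section \<open>Finite generation and coset covers\<close>

context group
begin

lemma cancel_left:
  "x \<in> carrier G \<Longrightarrow> y \<in> carrier G \<Longrightarrow> inv x \<otimes> (x \<otimes> y) = y"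
  "x \<in> carrier G \<Longrightarrow> y \<in> carrier G \<Longrightarrow> x \<otimes> (inv x \<otimes> y) = y"
  by (simp_all add: m_assoc[symmetric])

lemma conjugate_generate_mem:
  assumes U: "subgroup U G" and t: "t \<in> carrier G" and S: "S \<subseteq> carrier G"
    and conj: "\<And>s. s \<in> S \<Longrightarrow> t \<otimes> s \<otimes> inv t \<in> U"
    and x: "x \<in> generate G S"
  shows "t \<otimes> x \<otimes> inv t \<in> U"
  using x
proof (induction rule: generate.induct)
  case one
  then show ?case using t U by (simp add: subgroup.one_closed)
next
  case (incl s)
  then show ?case by (rule conj)
next
  case (inv s)
  then have "t \<otimes> inv s \<otimes> inv t = inv (t \<otimes> s \<otimes> inv t)"
    using t S by (simp add: inv_mult_group m_assoc subset_iff)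
  then show ?case using conj[OF inv] U by (simp add: subgroup.m_inv_closed)
next
  case (eng x y)
  have "x \<in> carrier G" "y \<in> carrier G"
    using eng generate_in_carrier[OF S] by auto
  then have "t \<otimes> (x \<otimes> y) \<otimes> inv t = (t \<otimes> x \<otimes> inv t) \<otimes> (t \<otimes> y \<otimes> inv t)"
    using t by (simp add: m_assoc cancel_left)
  then show ?case using eng U by (simp add: subgroup.m_closed)
qed

lemma finitely_generated_subgroupI:
  assumes "subgroup H G" "finite S" "S \<subseteq> H" "H \<subseteq> generate G S"
  shows "finitely_generated_subgroup G H"
  unfolding finitely_generated_subgroup_def
  using assms generate_subgroup_incl[of S H] by blast

lemma finite_rcosets_iff:
  assumes H: "subgroup H G"
  shows "finite (rcosets H) \<longleftrightarrow>
    (\<exists>T. finite T \<and> T \<subseteq> carrier G \<and> (\<forall>g\<in>carrier G. \<exists>h\<in>H. \<exists>t\<in>T. g = h \<otimes> t))"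
proof
  have eq: "rcosets H = (\<lambda>a. H #> a) ` carrier G"
    by (auto simp: RCOSETS_def)
  assume "finite (rcosets H)"
  then obtain T where T: "T \<subseteq> carrier G" "finite T" "rcosets H = (\<lambda>a. H #> a) ` T"
    using finite_subset_image[of "rcosets H" "\<lambda>a. H #> a" "carrier G"] eq by blast
  have "\<exists>h\<in>H. \<exists>t\<in>T. g = h \<otimes> t" if g: "g \<in> carrier G" for g
  proof -
    have "H #> g \<in> (\<lambda>a. H #> a) ` T" using T g eq by blast
    then obtain t where "t \<in> T" "H #> g = H #> t" by blast
    moreover have "g \<in> H #> g" using g H by (rule rcos_self)
    ultimately show ?thesis unfolding r_coset_def by blast
  qed
  then show "\<exists>T. finite T \<and> T \<subseteq> carrier G \<and> (\<forall>g\<in>carrier G. \<exists>h\<in>H. \<exists>t\<in>T. g = h \<otimes> t)"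
    using T by blast
next
  assume "\<exists>T. finite T \<and> T \<subseteq> carrier G \<and> (\<forall>g\<in>carrier G. \<exists>h\<in>H. \<exists>t\<in>T. g = h \<otimes> t)"
  then obtain T where T: "finite T" "T \<subseteq> carrier G"
    "\<And>g. g \<in> carrier G \<Longrightarrow> \<exists>h\<in>H. \<exists>t\<in>T. g = h \<otimes> t" by blast
  have "H #> g \<in> (\<lambda>t. H #> t) ` T" if g: "g \<in> carrier G" for g
  proof -
    obtain h t where ht: "h \<in> H" "t \<in> T" "g = h \<otimes> t" using T(3)[OF g] by blast
    then have "g \<in> H #> t" unfolding r_coset_def by blast
    then have "H #> t = H #> g" using ht T(2) H by (intro repr_independence) auto
    then show ?thesis using ht by blast
  qed
  then have "rcosets H \<subseteq> (\<lambda>t. H #> t) ` T" by (auto simp: RCOSETS_def)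
  then show "finite (rcosets H)" using T(1) finite_subset by blast
qed

lemma finite_index_mult_normal_iff:
  assumes N: "N \<lhd> G" and C: "subgroup C G"
  shows "finite_index G (N <#> C) \<longleftrightarrow>
    (\<exists>T. finite T \<and> T \<subseteq> carrier G \<and>
       (\<forall>g\<in>carrier G. \<exists>n\<in>N. \<exists>t\<in>T. \<exists>c\<in>C. g = n \<otimes> t \<otimes> c))"
proof -
  interpret N: normal N G by (rule N)
  interpret C: subgroup C G by (rule C)
  have NC: "subgroup (N <#> C) G" by (rule mult_norm_subgroup[OF N C])
  have "(\<exists>T. finite T \<and> T \<subseteq> carrier G \<and> (\<forall>g\<in>carrier G. \<exists>h\<in>N <#> C. \<exists>t\<in>T. g = h \<otimes> t)) \<longleftrightarrow>
    (\<exists>T. finite T \<and> T \<subseteq> carrier G \<and> (\<forall>g\<in>carrier G. \<exists>n\<in>N. \<exists>t\<in>T. \<exists>c\<in>C. g = n \<otimes> t \<otimes> c))"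
    (is "?L \<longleftrightarrow> ?R")
  proof
    assume ?L
    then obtain T where T: "finite T" "T \<subseteq> carrier G"
      "\<And>g. g \<in> carrier G \<Longrightarrow> \<exists>h\<in>N <#> C. \<exists>t\<in>T. g = h \<otimes> t" by blast
    have "\<exists>n\<in>N. \<exists>t\<in>m_inv G ` T. \<exists>c\<in>C. g = n \<otimes> t \<otimes> c" if g: "g \<in> carrier G" for g
    proof -
      obtain n c t where nct: "n \<in> N" "c \<in> C" "t \<in> T" "inv g = n \<otimes> c \<otimes> t"
        using T(3)[of "inv g"] g unfolding set_mult_def by auto
      have t: "t \<in> carrier G" using nct T(2) by blast
      have "g = inv (n \<otimes> c \<otimes> t)" using nct g by (metis inv_inv)
      also have "\<dots> = (inv t \<otimes> inv c \<otimes> inv n \<otimes> inv (inv t \<otimes> inv c)) \<otimes> inv t \<otimes> inv c"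
        using nct t by (simp add: inv_mult_group m_assoc cancel_left)
      finally have "g = (inv t \<otimes> inv c \<otimes> inv n \<otimes> inv (inv t \<otimes> inv c)) \<otimes> inv t \<otimes> inv c" .
      moreover have "inv t \<otimes> inv c \<otimes> inv n \<otimes> inv (inv t \<otimes> inv c) \<in> N"
        using nct t by (intro N.inv_op_closed2) auto
      moreover have "inv t \<in> m_inv G ` T" "inv c \<in> C" using nct by simp_all
      ultimately show ?thesis by (intro bexI)
    qed
    moreover have "finite (m_inv G ` T)" "m_inv G ` T \<subseteq> carrier G" using T(1,2) by auto
    ultimately show ?R by blast
  next
    assume ?R
    then obtain T where T: "finite T" "T \<subseteq> carrier G"
      "\<forall>g\<in>carrier G. \<exists>n\<in>N. \<exists>t\<in>T. \<exists>c\<in>C. g = n \<otimes> t \<otimes> c"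
      by (elim exE conjE) (rule that)
    have "\<exists>h\<in>N <#> C. \<exists>t\<in>m_inv G ` T. g = h \<otimes> t" if g: "g \<in> carrier G" for g
    proof -
      obtain n t c where nct: "n \<in> N" "t \<in> T" "c \<in> C" "inv g = n \<otimes> t \<otimes> c"
        using bspec[OF T(3), of "inv g"] g by auto
      have t: "t \<in> carrier G" using nct T(2) by blast
      have "g = inv (n \<otimes> t \<otimes> c)" using nct g by (metis inv_inv)
      also have "\<dots> = ((inv c \<otimes> inv t \<otimes> inv n \<otimes> inv (inv c \<otimes> inv t)) \<otimes> inv c) \<otimes> inv t"
        using nct t by (simp add: inv_mult_group m_assoc cancel_left)
      finally have "g = ((inv c \<otimes> inv t \<otimes> inv n \<otimes> inv (inv c \<otimes> inv t)) \<otimes> inv c) \<otimes> inv t" .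
      moreover have "inv c \<otimes> inv t \<otimes> inv n \<otimes> inv (inv c \<otimes> inv t) \<in> N"
        using nct t by (intro N.inv_op_closed2) auto
      then have "(inv c \<otimes> inv t \<otimes> inv n \<otimes> inv (inv c \<otimes> inv t)) \<otimes> inv c \<in> N <#> C"
        unfolding set_mult_def using C.m_inv_closed[OF nct(3)] by blast
      moreover have "inv t \<in> m_inv G ` T" using nct by simp
      ultimately show ?thesis by (intro bexI)
    qed
    moreover have "finite (m_inv G ` T)" "m_inv G ` T \<subseteq> carrier G" using T(1,2) by auto
    ultimately show ?L by blast
  qed
  then show ?thesis
    by (simp only: finite_index_def finite_rcosets_iff[OF NC] NC simp_thms)
qed

lemma generate_Un_induct [consumes 4, case_names one step]:
  assumes A: "subgroup A G" and B: "subgroup B G" and gen: "generate G (A \<union> B) = carrier G"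
    and g: "g \<in> carrier G" and one: "P \<one>"
    and step: "\<And>g x. g \<in> carrier G \<Longrightarrow> P g \<Longrightarrow> x \<in> A \<union> B \<Longrightarrow> P (g \<otimes> x)"
  shows "P g"
proof -
  interpret A: subgroup A G by (rule A)
  interpret B: subgroup B G by (rule B)
  have AB: "A \<union> B \<subseteq> carrier G" by auto
  have "P (g \<otimes> h)" if "h \<in> generate G (A \<union> B)" "g \<in> carrier G" "P g" for g h
    using that
  proof (induction arbitrary: g rule: generate.induct)
    case (inv x)
    then have "inv x \<in> A \<union> B" by auto
    then show ?case using inv step by blast
  next
    case (eng x y)
    then have "x \<in> carrier G" "y \<in> carrier G" using generate_in_carrier[OF AB] by auto
    then have "g \<otimes> (x \<otimes> y) = (g \<otimes> x) \<otimes> y" using eng by (simp add: m_assoc)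
    then show ?case using eng \<open>x \<in> carrier G\<close> by simp
  qed (use step in auto)
  from this[of g \<one>] show ?thesis using g gen one by simp
qed

text \<open>
  If \<open>G\<close> is a finite union of double cosets \<open>N t C\<close> and \<open>N \<inter> X\<close> is finitely generated, then finitely
  many elements of \<open>N\<close> make \<open>U T C\<close> stable under right multiplication by \<open>X\<close> for every subgroup \<open>U\<close>
  containing them: the generators of the stabilizers \<open>t (N \<inter> X) inv t\<close>, and one element of \<open>N\<close> for each
  pair of representatives whose double cosets meet a common coset of \<open>X\<close>.
\<close>

lemma finite_absorbing_set:
  assumes N: "N \<lhd> G" and X: "subgroup X G" and C: "subgroup C G" and CX: "C \<subseteq> X"
    and T: "finite T" "T \<subseteq> carrier G"
    and cover: "\<forall>g\<in>carrier G. \<exists>n\<in>N. \<exists>t\<in>T. \<exists>c\<in>C. g = n \<otimes> t \<otimes> c"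
    and fg: "finitely_generated_subgroup G (N \<inter> X)"
  obtains F where "finite F" "F \<subseteq> N"
    "\<And>U u t c x. subgroup U G \<Longrightarrow> F \<subseteq> U \<Longrightarrow> u \<in> U \<Longrightarrow> t \<in> T \<Longrightarrow> c \<in> C \<Longrightarrow> x \<in> X \<Longrightarrow>
       \<exists>u'\<in>U. \<exists>t'\<in>T. \<exists>c'\<in>C. u \<otimes> t \<otimes> c \<otimes> x = u' \<otimes> t' \<otimes> c'"
proof -
  interpret N: normal N G by (rule N)
  interpret X: subgroup X G by (rule X)
  interpret C: subgroup C G by (rule C)
  obtain S where S: "finite S" "S \<subseteq> N \<inter> X" "generate G S = N \<inter> X"
    using fg unfolding finitely_generated_subgroup_def by blast
  define E where "E = {(t, t') \<in> T \<times> T. \<exists>n. n \<in> N \<and> inv t \<otimes> n \<otimes> t' \<in> X}"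
  define f where "f = (\<lambda>(t, t'). SOME n. n \<in> N \<and> inv t \<otimes> n \<otimes> t' \<in> X)"
  have f: "f (t, t') \<in> N \<and> inv t \<otimes> f (t, t') \<otimes> t' \<in> X" if "(t, t') \<in> E" for t t'
    using that someI_ex[of "\<lambda>n. n \<in> N \<and> inv t \<otimes> n \<otimes> t' \<in> X"] by (simp add: E_def f_def)
  define F where "F = (\<lambda>(t, s). t \<otimes> s \<otimes> inv t) ` (T \<times> S) \<union> f ` E"
  have "E \<subseteq> T \<times> T" by (auto simp: E_def)
  then have "finite E" using T(1) finite_subset by blast
  then have "finite F" using T(1) S(1) by (simp add: F_def)
  moreover have "F \<subseteq> N"
    using f S(2) T(2) by (auto simp: F_def intro!: N.inv_op_closed2)
  moreover have "\<exists>u'\<in>U. \<exists>t'\<in>T. \<exists>c'\<in>C. u \<otimes> t \<otimes> c \<otimes> x = u' \<otimes> t' \<otimes> c'"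
    if U: "subgroup U G" "F \<subseteq> U" and u: "u \<in> U" and t: "t \<in> T" and c: "c \<in> C" and x: "x \<in> X"
    for U u t c x
  proof -
    interpret U: subgroup U G by (rule U)
    have tG: "t \<in> carrier G" using t T by auto
    have cX: "c \<in> X" using c CX by auto
    define y where "y = c \<otimes> x"
    have y: "y \<in> X" using cX x by (simp add: y_def)
    obtain n t' c' where ntc: "n \<in> N" "t' \<in> T" "c' \<in> C" "t \<otimes> y = n \<otimes> t' \<otimes> c'"
      using bspec[OF cover, of "t \<otimes> y"] tG y by auto
    have t'G: "t' \<in> carrier G" using ntc(2) T by auto
    have c'X: "c' \<in> X" using ntc(3) CX by auto
    have n: "n = t \<otimes> y \<otimes> inv c' \<otimes> inv t'"
      using ntc tG t'G y by (simp add: m_assoc)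
    then have "inv t \<otimes> n \<otimes> t' = y \<otimes> inv c'"
      using tG t'G y c'X by (simp add: m_assoc cancel_left)
    then have tt: "(t, t') \<in> E"
      using t ntc y c'X by (auto simp: E_def)
    define m where "m = f (t, t')"
    define z where "z = inv t \<otimes> m \<otimes> t'"
    have m: "m \<in> N" "z \<in> X" using f[OF tt] by (simp_all add: m_def z_def)
    have mU: "m \<in> U" using U(2) tt by (auto simp: F_def m_def)
    have mz: "m = t \<otimes> z \<otimes> inv t'" using m tG t'G by (simp add: z_def m_assoc cancel_left)
    define w where "w = y \<otimes> inv c' \<otimes> inv z"
    have wX: "w \<in> X" using y c'X m by (simp add: w_def)
    have nm: "n \<otimes> inv m = t \<otimes> w \<otimes> inv t"
      unfolding n mz w_def using tG t'G y c'X m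
      by (simp add: inv_mult_group m_assoc cancel_left)
    have "w = inv t \<otimes> (n \<otimes> inv m) \<otimes> t"
      unfolding nm using tG wX by (simp add: m_assoc cancel_left)
    then have "w \<in> N" using ntc(1) m(1) tG by (simp add: N.inv_op_closed1)
    then have "w \<in> generate G S" using wX S by simp
    then have "t \<otimes> w \<otimes> inv t \<in> U"
    proof (rule conjugate_generate_mem[OF U(1) tG, rotated 2])
      show "S \<subseteq> carrier G" using S by auto
      show "t \<otimes> s \<otimes> inv t \<in> U" if "s \<in> S" for s
        using that t U(2) by (force simp: F_def)
    qed
    then have "n \<otimes> inv m \<otimes> m \<in> U" unfolding nm[symmetric] using mU by simp
    then have "n \<in> U" using ntc m by (simp add: m_assoc)
    then have "u \<otimes> n \<in> U" using u by simp
    moreover have "u \<otimes> t \<otimes> c \<otimes> x = (u \<otimes> n) \<otimes> t' \<otimes> c'"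
    proof -
      have "u \<otimes> t \<otimes> c \<otimes> x = u \<otimes> (t \<otimes> y)" using u tG cX x by (simp add: y_def m_assoc)
      then show ?thesis using u ntc t'G by (simp add: m_assoc)
    qed
    ultimately show ?thesis using ntc by auto
  qed
  ultimately show thesis by (rule that)
qed

text \<open>
  For subgroups \<open>A\<close> and \<open>B\<close> containing \<open>C\<close>, the assumption \<open>gen\<close> says that the coset graph with edges
  \<open>g C\<close> and vertices \<open>g A\<close> and \<open>g B\<close> is connected. It need not be a tree.
\<close>

lemma finitely_generated_of_factors:
  assumes N: "N \<lhd> G" and A: "subgroup A G" and B: "subgroup B G" and C: "subgroup C G"
    and CA: "C \<subseteq> A" and CB: "C \<subseteq> B" and gen: "generate G (A \<union> B) = carrier G"
    and fin: "finite_index G (N <#> C)"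
    and fgA: "finitely_generated_subgroup G (N \<inter> A)"
    and fgB: "finitely_generated_subgroup G (N \<inter> B)"
  shows "finitely_generated_subgroup G N"
proof -
  interpret N: normal N G by (rule N)
  interpret A: subgroup A G by (rule A)
  interpret C: subgroup C G by (rule C)
  obtain T0 where T0: "finite T0" "T0 \<subseteq> carrier G"
    "\<forall>g\<in>carrier G. \<exists>n\<in>N. \<exists>t\<in>T0. \<exists>c\<in>C. g = n \<otimes> t \<otimes> c"
    using fin unfolding finite_index_mult_normal_iff[OF N C] by (elim exE conjE) (rule that)
  define T where "T = insert \<one> T0"
  have T: "finite T" "T \<subseteq> carrier G" using T0 by (simp_all add: T_def)
  have cover: "\<forall>g\<in>carrier G. \<exists>n\<in>N. \<exists>t\<in>T. \<exists>c\<in>C. g = n \<otimes> t \<otimes> c"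
    using T0(3) unfolding T_def by (meson insertI2)
  obtain FA where FA: "finite FA" "FA \<subseteq> N"
    "\<And>U u t c x. subgroup U G \<Longrightarrow> FA \<subseteq> U \<Longrightarrow> u \<in> U \<Longrightarrow> t \<in> T \<Longrightarrow> c \<in> C \<Longrightarrow> x \<in> A \<Longrightarrow>
       \<exists>u'\<in>U. \<exists>t'\<in>T. \<exists>c'\<in>C. u \<otimes> t \<otimes> c \<otimes> x = u' \<otimes> t' \<otimes> c'"
    by (rule finite_absorbing_set[OF N A C CA T cover fgA]) (rule that)
  obtain FB where FB: "finite FB" "FB \<subseteq> N"
    "\<And>U u t c x. subgroup U G \<Longrightarrow> FB \<subseteq> U \<Longrightarrow> u \<in> U \<Longrightarrow> t \<in> T \<Longrightarrow> c \<in> C \<Longrightarrow> x \<in> B \<Longrightarrow>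
       \<exists>u'\<in>U. \<exists>t'\<in>T. \<exists>c'\<in>C. u \<otimes> t \<otimes> c \<otimes> x = u' \<otimes> t' \<otimes> c'"
    by (rule finite_absorbing_set[OF N B C CB T cover fgB]) (rule that)
  obtain S where S: "finite S" "S \<subseteq> N \<inter> A" "generate G S = N \<inter> A"
    using fgA unfolding finitely_generated_subgroup_def by blast
  define f where "f t = (SOME n. n \<in> N \<and> inv n \<otimes> t \<in> C)" for t
  define E where "E = {t \<in> T. \<exists>n. n \<in> N \<and> inv n \<otimes> t \<in> C}"
  have f: "f t \<in> N \<and> inv (f t) \<otimes> t \<in> C" if "t \<in> E" for t
    using that someI_ex[of "\<lambda>n. n \<in> N \<and> inv n \<otimes> t \<in> C"] by (simp add: E_def f_def)
  define F where "F = FA \<union> FB \<union> S \<union> f ` E"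
  have "f ` E \<subseteq> N" using f by (intro image_subsetI) simp
  moreover have "finite E" using T(1) by (simp add: E_def)
  ultimately have F: "finite F" "F \<subseteq> N"
    using FA(1,2) FB(1,2) S(1,2) by (auto simp: F_def)
  define U where "U = generate G F"
  have FU: "F \<subseteq> U" by (auto simp: U_def intro: generate.incl)
  have U: "subgroup U G"
    unfolding U_def by (rule generate_is_subgroup) (use F in auto)
  interpret U: subgroup U G by (rule U)
  have UTC: "\<exists>u\<in>U. \<exists>t\<in>T. \<exists>c\<in>C. g = u \<otimes> t \<otimes> c" if "g \<in> carrier G" for g
    using A B gen that
  proof (induction rule: generate_Un_induct)
    case one
    show ?case by (intro bexI[of _ \<one>]) (auto simp: T_def)
  next
    case (step g x)
    obtain u t c where utc: "u \<in> U" "t \<in> T" "c \<in> C" "g = u \<otimes> t \<otimes> c"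
      using step.IH by (elim bexE) (rule that)
    show ?case
    proof (cases "x \<in> A")
      case True
      have "FA \<subseteq> U" using FU by (auto simp: F_def)
      from FA(3)[OF U this utc(1-3) True] show ?thesis unfolding utc(4) .
    next
      case False
      then have "x \<in> B" using step by simp
      have "FB \<subseteq> U" using FU by (auto simp: F_def)
      from FB(3)[OF U this utc(1-3) \<open>x \<in> B\<close>] show ?thesis unfolding utc(4) .
    qed
  qed
  have "n \<in> U" if n: "n \<in> N" for n
  proof -
    have UN: "U \<subseteq> N" unfolding U_def by (rule generate_subgroup_incl[OF F(2) N.is_subgroup])
    obtain u t c where utc: "u \<in> U" "t \<in> T" "c \<in> C" "n = u \<otimes> t \<otimes> c"
      using UTC[OF N.mem_carrier[OF n]] by (elim bexE) (rule that)
    have tG: "t \<in> carrier G" using utc T by auto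
    have uN: "u \<in> N" using utc UN by auto
    \<comment> \<open>As \<open>t\<close> lies in \<open>N C\<close>, it may be replaced by the chosen element of \<open>N \<inter> t C\<close>; what remains
      is an element of \<open>N \<inter> C\<close>.\<close>
    have t: "t = inv u \<otimes> n \<otimes> inv c" using utc tG by (simp add: m_assoc cancel_left)
    have "inv (inv u \<otimes> n) \<otimes> t = inv c"
      unfolding t using uN n utc(3) by (simp add: inv_mult_group m_assoc cancel_left)
    moreover have "inv u \<otimes> n \<in> N" using uN n by simp
    ultimately have "t \<in> E" using utc(2,3) by (auto simp: E_def intro!: exI[of _ "inv u \<otimes> n"])
    then have ft: "f t \<in> N" "inv (f t) \<otimes> t \<in> C" using f by simp_all
    have "f t \<in> F" using \<open>t \<in> E\<close> by (simp add: F_def)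
    then have fU: "f t \<in> U" using FU by auto
    define d where "d = inv (f t) \<otimes> t \<otimes> c"
    have dC: "d \<in> C" using ft utc by (simp add: d_def)
    have nd: "n = u \<otimes> f t \<otimes> d" using ft tG utc by (simp add: d_def m_assoc cancel_left)
    have "d = inv (u \<otimes> f t) \<otimes> n"
      unfolding nd using ft uN dC by (simp add: inv_mult_group m_assoc cancel_left)
    then have "d \<in> N" using uN ft n by simp
    then have "d \<in> generate G S" using dC CA S by auto
    moreover have "generate G S \<subseteq> U"
      by (rule generate_subgroup_incl[OF _ U]) (use FU in \<open>auto simp: F_def\<close>)
    ultimately have "d \<in> U" by auto
    then show ?thesis unfolding nd using utc(1) fU by simp
  qed
  then show ?thesis
    using finitely_generated_subgroupI[OF N.is_subgroup F] by (auto simp: U_def)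
qed

lemma finite_quotient_iff:
  assumes N: "N \<lhd> G" and C: "subgroup C G" and fin: "finite_index G (N <#> C)"
  shows "finite (carrier (G Mod N)) \<longleftrightarrow> finite (carrier ((G\<lparr>carrier := C\<rparr>) Mod (N \<inter> C)))"
proof -
  interpret N: normal N G by (rule N)
  interpret C: subgroup C G by (rule C)
  interpret H: group "G\<lparr>carrier := C\<rparr>" by (rule subgroup_imp_group[OF C])
  have NC: "subgroup (N \<inter> C) (G\<lparr>carrier := C\<rparr>)"
    by (intro subgroup_incl subgroups_Inter_pair N.is_subgroup C) auto
  have "finite (rcosets N) \<longleftrightarrow> finite (rcosets\<^bsub>G\<lparr>carrier := C\<rparr>\<^esub> (N \<inter> C))"
    unfolding finite_rcosets_iff[OF N.is_subgroup] H.finite_rcosets_iff[OF NC]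
  proof
    assume "\<exists>T. finite T \<and> T \<subseteq> carrier G \<and> (\<forall>g\<in>carrier G. \<exists>h\<in>N. \<exists>t\<in>T. g = h \<otimes> t)"
    then obtain T where T: "finite T" "T \<subseteq> carrier G"
      "\<forall>g\<in>carrier G. \<exists>h\<in>N. \<exists>t\<in>T. g = h \<otimes> t" by (elim exE conjE) (rule that)
    define f where "f t = (SOME c. c \<in> C \<and> c \<otimes> inv t \<in> N)" for t
    define E where "E = {t \<in> T. \<exists>c. c \<in> C \<and> c \<otimes> inv t \<in> N}"
    have f: "f t \<in> C \<and> f t \<otimes> inv t \<in> N" if "t \<in> E" for t
      using that someI_ex[of "\<lambda>c. c \<in> C \<and> c \<otimes> inv t \<in> N"] by (simp add: E_def f_def)
    have "\<exists>h\<in>N \<inter> C. \<exists>t\<in>f ` E. g = h \<otimes> t" if g: "g \<in> C" for g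
    proof -
      obtain h t where ht: "h \<in> N" "t \<in> T" "g = h \<otimes> t"
        using bspec[OF T(3), of g] g by auto
      have tG: "t \<in> carrier G" using ht T by auto
      have "g \<otimes> inv t = h" using ht tG by (simp add: m_assoc)
      then have tE: "t \<in> E" using ht g by (auto simp: E_def)
      then have ft: "f t \<in> C" "f t \<otimes> inv t \<in> N" using f by auto
      have "g \<otimes> inv (f t) = h \<otimes> inv (f t \<otimes> inv t)"
        using ht tG ft by (simp add: inv_mult_group m_assoc)
      then have "g \<otimes> inv (f t) \<in> N" using ht ft by simp
      moreover have "g \<otimes> inv (f t) \<in> C" using g ft by simp
      moreover have "g = g \<otimes> inv (f t) \<otimes> f t" using g ft by (simp add: m_assoc)
      ultimately show ?thesis using tE by blast
    qed
    moreover have "finite (f ` E)" "f ` E \<subseteq> C" using T f by (auto simp: E_def)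
    ultimately show "\<exists>T. finite T \<and> T \<subseteq> carrier (G\<lparr>carrier := C\<rparr>) \<and>
      (\<forall>g\<in>carrier (G\<lparr>carrier := C\<rparr>). \<exists>h\<in>N \<inter> C. \<exists>t\<in>T. g = h \<otimes>\<^bsub>G\<lparr>carrier := C\<rparr>\<^esub> t)"
      by (intro exI[of _ "f ` E"]) simp
  next
    assume "\<exists>T. finite T \<and> T \<subseteq> carrier (G\<lparr>carrier := C\<rparr>) \<and>
      (\<forall>g\<in>carrier (G\<lparr>carrier := C\<rparr>). \<exists>h\<in>N \<inter> C. \<exists>t\<in>T. g = h \<otimes>\<^bsub>G\<lparr>carrier := C\<rparr>\<^esub> t)"
    then obtain T where T: "finite T" "T \<subseteq> C" "\<forall>g\<in>C. \<exists>h\<in>N \<inter> C. \<exists>t\<in>T. g = h \<otimes> t"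
      by (elim exE conjE) (rule that, simp_all)
    obtain T' where T': "finite T'" "T' \<subseteq> carrier G"
      "\<forall>g\<in>carrier G. \<exists>n\<in>N. \<exists>t\<in>T'. \<exists>c\<in>C. g = n \<otimes> t \<otimes> c"
      using fin unfolding finite_index_mult_normal_iff[OF N C] by (elim exE conjE) (rule that)
    define P where "P = (\<lambda>(t, s). t \<otimes> s) ` (T' \<times> T)"
    have "\<exists>h\<in>N. \<exists>t\<in>P. g = h \<otimes> t" if g: "g \<in> carrier G" for g
    proof -
      obtain n t c where ntc: "n \<in> N" "t \<in> T'" "c \<in> C" "g = n \<otimes> t \<otimes> c"
        using bspec[OF T'(3) g] by auto
      obtain m s where ms: "m \<in> N" "s \<in> T" "c = m \<otimes> s" using bspec[OF T(3) ntc(3)] by auto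
      have tG: "t \<in> carrier G" "s \<in> carrier G" using ntc T' ms T by auto
      have "g = (n \<otimes> (t \<otimes> m \<otimes> inv t)) \<otimes> (t \<otimes> s)"
        using ntc ms tG by (simp add: m_assoc cancel_left)
      moreover have "n \<otimes> (t \<otimes> m \<otimes> inv t) \<in> N"
        using ntc ms tG by (simp add: N.inv_op_closed2)
      moreover have "t \<otimes> s \<in> P" using ntc ms by (auto simp: P_def)
      ultimately show ?thesis by blast
    qed
    moreover have "finite P" using T(1) T'(1) by (simp add: P_def)
    moreover have "P \<subseteq> carrier G"
    proof
      fix p assume "p \<in> P"
      then obtain t s where "t \<in> T'" "s \<in> T" "p = t \<otimes> s" by (auto simp: P_def)
      moreover have "t \<in> carrier G" "s \<in> carrier G" using calculation T(2) T'(2) by auto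
      ultimately show "p \<in> carrier G" by simp
    qed
    ultimately show "\<exists>T. finite T \<and> T \<subseteq> carrier G \<and> (\<forall>g\<in>carrier G. \<exists>h\<in>N. \<exists>t\<in>T. g = h \<otimes> t)"
      by (intro exI[of _ P]) simp
  qed
  then show ?thesis by (simp add: FactGroup_def)
qed

end

section \<open>Paths in coset graphs\<close>

text \<open>One step inside \<open>X\<close> in the Cayley graph of \<open>G\<close> with respect to the set of letters \<open>L\<close>. For
  \<open>L = A \<union> B\<close> the endpoints represent edges \<open>g C\<close> and \<open>h C\<close> of the tree with a common vertex.\<close>

definition path_step :: "('a, 'm) monoid_scheme \<Rightarrow> 'a set \<Rightarrow> 'a set \<Rightarrow> ('a \<times> 'a) set" where
  "path_step G L X = {(g, h). g \<in> X \<and> h \<in> X \<and> inv\<^bsub>G\<^esub> g \<otimes>\<^bsub>G\<^esub> h \<in> L}"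

lemma rtrancl_image:
  assumes "\<And>x y. (x, y) \<in> r \<Longrightarrow> (f x, f y) \<in> r" and "(x, y) \<in> r\<^sup>*"
  shows "(f x, f y) \<in> r\<^sup>*"
  using assms(2) by (induction rule: rtrancl_induct)
    (auto intro: rtrancl.rtrancl_into_rtrancl assms(1))

lemma (in group) generate_reachable:
  assumes N: "subgroup N G" and S: "S \<subseteq> N" and sym: "sym r"
    and inv: "\<And>n g h. n \<in> N \<Longrightarrow> (g, h) \<in> r \<Longrightarrow> (n \<otimes> g, n \<otimes> h) \<in> r"
    and start: "\<And>s. s \<in> S \<Longrightarrow> (\<one>, s) \<in> r\<^sup>*"
    and n: "n \<in> generate G S"
  shows "(\<one>, n) \<in> r\<^sup>*"
proof -
  interpret N: subgroup N G by (rule N)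
  have tr: "(n \<otimes> g, n \<otimes> h) \<in> r\<^sup>*" if "n \<in> N" "(g, h) \<in> r\<^sup>*" for n g h
    by (rule rtrancl_image[where f = "\<lambda>x. n \<otimes> x", OF _ that(2)]) (rule inv[OF that(1)])
  have gN: "generate G S \<subseteq> N" using generate_subgroup_incl[OF S N] .
  show ?thesis using n
  proof (induction rule: generate.induct)
    case one
    then show ?case by simp
  next
    case (incl s)
    then show ?case by (rule start)
  next
    case (inv s)
    then have "(inv s \<otimes> \<one>, inv s \<otimes> s) \<in> r\<^sup>*" using S by (intro tr start) auto
    then have "(inv s, \<one>) \<in> r\<^sup>*" using inv S by (auto simp: subset_iff)
    then show ?case using sym sym_rtrancl symD by metis
  next
    case (eng x y)
    then have x: "x \<in> N" "y \<in> N" using gN by auto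
    then have "(x, x \<otimes> y) \<in> r\<^sup>*" using tr[OF x(1) eng.IH(2)] by simp
    then show ?case using eng.IH(1) by simp
  qed
qed

text \<open>
  Adjacency of edges after the vertices \<open>n A\<close>, for \<open>n\<close> in \<open>N\<close>, have been split. Two edges at a vertex
  \<open>g B\<close>, or at a vertex \<open>g A\<close> outside the \<open>N\<close>-orbit of \<open>A\<close>, are adjacent; two edges at \<open>n A\<close> are
  adjacent only if they lie in a common translate by \<open>N\<close> of the set \<open>P\<close> of edges kept together.
\<close>

definition split_step ::
  "('a, 'm) monoid_scheme \<Rightarrow> 'a set \<Rightarrow> 'a set \<Rightarrow> 'a set \<Rightarrow> 'a set \<Rightarrow> ('a \<times> 'a) set" where
  "split_step G N A B P = {(g, h). g \<in> carrier G \<and> h \<in> carrier G \<and>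
     (inv\<^bsub>G\<^esub> g \<otimes>\<^bsub>G\<^esub> h \<in> B \<or>
      inv\<^bsub>G\<^esub> g \<otimes>\<^bsub>G\<^esub> h \<in> A \<and>
      (g \<notin> N <#>\<^bsub>G\<^esub> A \<or> (\<exists>n\<in>N. \<exists>p\<in>P. \<exists>q\<in>P. g = n \<otimes>\<^bsub>G\<^esub> p \<and> h = n \<otimes>\<^bsub>G\<^esub> q)))}"

context group
begin

lemma sym_split_step:
  assumes N: "subgroup N G" and A: "subgroup A G" and B: "subgroup B G"
  shows "sym (split_step G N A B P)"
proof (rule symI)
  interpret N: subgroup N G by (rule N)
  interpret A: subgroup A G by (rule A)
  interpret B: subgroup B G by (rule B)
  fix g h assume gh: "(g, h) \<in> split_step G N A B P"
  have c: "g \<in> carrier G" "h \<in> carrier G" using gh by (auto simp: split_step_def)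
  have inv: "inv h \<otimes> g = inv (inv g \<otimes> h)" using c by (simp add: inv_mult_group)
  have "g \<in> N <#> A" if hNA: "h \<in> N <#> A" and x: "inv g \<otimes> h \<in> A"
  proof -
    obtain n y where ny: "n \<in> N" "y \<in> A" "h = n \<otimes> y" using hNA unfolding set_mult_def by blast
    have "inv h \<otimes> g \<in> A" unfolding inv using x by simp
    then have "y \<otimes> (inv h \<otimes> g) \<in> A" using ny by simp
    moreover have "g = h \<otimes> (inv h \<otimes> g)" using c by (simp add: cancel_left)
    then have "g = n \<otimes> (y \<otimes> (inv h \<otimes> g))" using ny c by (simp add: m_assoc)
    ultimately show ?thesis using ny unfolding set_mult_def by blast
  qed
  moreover have "inv h \<otimes> g \<in> A" if "inv g \<otimes> h \<in> A" unfolding inv using that by simp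
  moreover have "inv h \<otimes> g \<in> B" if "inv g \<otimes> h \<in> B" unfolding inv using that by simp
  moreover have "\<exists>n\<in>N. \<exists>p\<in>P. \<exists>q\<in>P. h = n \<otimes> p \<and> g = n \<otimes> q"
    if "\<exists>n\<in>N. \<exists>p\<in>P. \<exists>q\<in>P. g = n \<otimes> p \<and> h = n \<otimes> q"
    using that by (elim bexE conjE) (intro bexI conjI)
  moreover have "inv g \<otimes> h \<in> B \<or> inv g \<otimes> h \<in> A \<and>
      (g \<notin> N <#> A \<or> (\<exists>n\<in>N. \<exists>p\<in>P. \<exists>q\<in>P. g = n \<otimes> p \<and> h = n \<otimes> q))"
    using gh by (simp add: split_step_def)
  ultimately have "inv h \<otimes> g \<in> B \<or> inv h \<otimes> g \<in> A \<and>
      (h \<notin> N <#> A \<or> (\<exists>n\<in>N. \<exists>p\<in>P. \<exists>q\<in>P. h = n \<otimes> p \<and> g = n \<otimes> q))"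
    by argo
  then show "(h, g) \<in> split_step G N A B P"
    using c by (simp add: split_step_def)
qed

lemma split_step_translate:
  assumes N: "subgroup N G" and A: "subgroup A G" and P: "P \<subseteq> carrier G"
    and m: "m \<in> N" and gh: "(g, h) \<in> split_step G N A B P"
  shows "(m \<otimes> g, m \<otimes> h) \<in> split_step G N A B P"
proof -
  interpret N: subgroup N G by (rule N)
  interpret A: subgroup A G by (rule A)
  have c: "g \<in> carrier G" "h \<in> carrier G" using gh by (auto simp: split_step_def)
  have eq: "inv (m \<otimes> g) \<otimes> (m \<otimes> h) = inv g \<otimes> h"
    using c m by (simp add: inv_mult_group m_assoc cancel_left)
  have "g \<in> N <#> A" if mg: "m \<otimes> g \<in> N <#> A"
  proof -
    obtain n y where ny: "n \<in> N" "y \<in> A" "m \<otimes> g = n \<otimes> y"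
      using mg unfolding set_mult_def by blast
    have "g = inv m \<otimes> (m \<otimes> g)" using m c by (simp add: cancel_left)
    then have "g = (inv m \<otimes> n) \<otimes> y" using ny m by (simp add: m_assoc)
    moreover have "inv m \<otimes> n \<in> N" using m ny by simp
    ultimately show ?thesis using ny(2) unfolding set_mult_def by blast
  qed
  moreover have "\<exists>n\<in>N. \<exists>p\<in>P. \<exists>q\<in>P. m \<otimes> g = n \<otimes> p \<and> m \<otimes> h = n \<otimes> q"
    if ex: "\<exists>n\<in>N. \<exists>p\<in>P. \<exists>q\<in>P. g = n \<otimes> p \<and> h = n \<otimes> q"
  proof -
    obtain n p q where npq: "n \<in> N" "p \<in> P" "q \<in> P" "g = n \<otimes> p" "h = n \<otimes> q"
      using ex by (elim bexE conjE) (rule that)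
    have "p \<in> carrier G" "q \<in> carrier G" using npq P by auto
    then have "m \<otimes> g = (m \<otimes> n) \<otimes> p" "m \<otimes> h = (m \<otimes> n) \<otimes> q"
      using npq m by (simp_all add: m_assoc)
    moreover have "m \<otimes> n \<in> N" using m npq by simp
    ultimately show ?thesis using npq(2,3) by (intro bexI conjI)
  qed
  moreover have "inv g \<otimes> h \<in> B \<or> inv g \<otimes> h \<in> A \<and>
      (g \<notin> N <#> A \<or> (\<exists>n\<in>N. \<exists>p\<in>P. \<exists>q\<in>P. g = n \<otimes> p \<and> h = n \<otimes> q))"
    using gh by (simp add: split_step_def)
  ultimately have "inv g \<otimes> h \<in> B \<or> inv g \<otimes> h \<in> A \<and> (m \<otimes> g \<notin> N <#> A \<or>
      (\<exists>n\<in>N. \<exists>p\<in>P. \<exists>q\<in>P. m \<otimes> g = n \<otimes> p \<and> m \<otimes> h = n \<otimes> q))"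
    by argo
  then show ?thesis using c m eq by (simp add: split_step_def)
qed

lemma finite_double_coset_representatives:
  assumes N: "N \<lhd> G" and A: "subgroup A G" and C: "subgroup C G" and CA: "C \<subseteq> A"
    and T: "finite T" "T \<subseteq> carrier G"
    and cover: "\<forall>g\<in>carrier G. \<exists>n\<in>N. \<exists>t\<in>T. \<exists>c\<in>C. g = n \<otimes> t \<otimes> c"
  obtains R where "finite R" "R \<subseteq> A" "\<one> \<in> R"
    "\<forall>x\<in>A. \<exists>v\<in>N \<inter> A. \<exists>r\<in>R. \<exists>c\<in>C. x = v \<otimes> r \<otimes> c"
proof -
  interpret N: normal N G by (rule N)
  interpret A: subgroup A G by (rule A)
  interpret C: subgroup C G by (rule C)
  define E where "E = {t \<in> T. \<exists>y. y \<in> A \<and> (\<exists>n\<in>N. \<exists>c\<in>C. y = n \<otimes> t \<otimes> c)}"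
  define f where "f t = (SOME y. y \<in> A \<and> (\<exists>n\<in>N. \<exists>c\<in>C. y = n \<otimes> t \<otimes> c))" for t
  have f: "f t \<in> A \<and> (\<exists>n\<in>N. \<exists>c\<in>C. f t = n \<otimes> t \<otimes> c)" if "t \<in> E" for t
    using that someI_ex[of "\<lambda>y. y \<in> A \<and> (\<exists>n\<in>N. \<exists>c\<in>C. y = n \<otimes> t \<otimes> c)"]
    by (simp add: E_def f_def)
  have "finite (insert \<one> (f ` E))" using T(1) by (simp add: E_def)
  moreover have "f ` E \<subseteq> A" using f by (intro image_subsetI) simp
  then have "insert \<one> (f ` E) \<subseteq> A" by simp
  moreover have "\<exists>v\<in>N \<inter> A. \<exists>r\<in>insert \<one> (f ` E). \<exists>c\<in>C. x = v \<otimes> r \<otimes> c" if x: "x \<in> A" for x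
  proof -
    obtain n t c where ntc: "n \<in> N" "t \<in> T" "c \<in> C" "x = n \<otimes> t \<otimes> c"
      using bspec[OF cover, of x] x by auto
    have tE: "t \<in> E" using ntc x unfolding E_def by blast
    obtain n' c' where ntc': "n' \<in> N" "c' \<in> C" "f t = n' \<otimes> t \<otimes> c'"
      using f[OF tE] by (elim bexE conjE) (rule that)
    have fA: "f t \<in> A" using f[OF tE] by simp
    have tG: "t \<in> carrier G" using ntc T by auto
    have cA: "c \<in> A" "c' \<in> A" using ntc ntc' CA by auto
    have x1: "x = (n \<otimes> inv n') \<otimes> f t \<otimes> (inv c' \<otimes> c)"
      unfolding ntc'(3) ntc(4) using ntc(1,3) ntc'(1,2) tG by (simp add: m_assoc cancel_left)
    have "n \<otimes> inv n' = x \<otimes> inv (f t \<otimes> (inv c' \<otimes> c))"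
      unfolding x1 using ntc(1,3) ntc'(1,2) fA by (simp add: inv_mult_group m_assoc cancel_left)
    moreover have "x \<otimes> inv (f t \<otimes> (inv c' \<otimes> c)) \<in> A" using x fA cA by simp
    moreover have "n \<otimes> inv n' \<in> N" using ntc(1) ntc'(1) by simp
    ultimately have "n \<otimes> inv n' \<in> N \<inter> A" by simp
    moreover have "inv c' \<otimes> c \<in> C" using ntc(3) ntc'(2) by simp
    moreover have "f t \<in> insert \<one> (f ` E)" using tE by simp
    ultimately show ?thesis using x1 by (intro bexI)
  qed
  ultimately show thesis by (intro that[of "insert \<one> (f ` E)"]) simp_all
qed

text \<open>
  The elements \<open>v\<close> of \<open>N \<inter> A\<close> that carry the edge \<open>t C\<close> to \<open>t' C\<close> form a coset of the stabilizer
  \<open>N \<inter> t' C (inv t')\<close>, which is conjugate to \<open>N \<inter> C\<close>. Hence finitely many elements suffice to place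
  all of them in a subgroup.
\<close>

lemma finite_linking_set:
  assumes N: "N \<lhd> G" and A: "subgroup A G" and C: "subgroup C G" and CA: "C \<subseteq> A"
    and fg: "finitely_generated_subgroup G (N \<inter> C)" and t: "t \<in> A" and t': "t' \<in> A"
  shows "\<exists>F. finite F \<and> F \<subseteq> N \<inter> A \<and> (\<forall>U v c. subgroup U G \<longrightarrow> F \<subseteq> U \<longrightarrow>
    v \<in> N \<inter> A \<longrightarrow> c \<in> C \<longrightarrow> v \<otimes> t \<otimes> c = t' \<longrightarrow> v \<in> U)"
proof (cases "\<exists>w c. w \<in> N \<inter> A \<and> c \<in> C \<and> w \<otimes> t \<otimes> c = t'")
  case False
  then show ?thesis by (intro exI[of _ "{}"]) blast
next
  case True
  interpret N: normal N G by (rule N)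
  interpret A: subgroup A G by (rule A)
  interpret C: subgroup C G by (rule C)
  obtain w e where we: "w \<in> N \<inter> A" "e \<in> C" "w \<otimes> t \<otimes> e = t'" using True by blast
  obtain S where S: "finite S" "S \<subseteq> N \<inter> C" "generate G S = N \<inter> C"
    using fg unfolding finitely_generated_subgroup_def by blast
  define F where "F = insert w ((\<lambda>s. t' \<otimes> s \<otimes> inv t') ` S)"
  have conj: "t' \<otimes> s \<otimes> inv t' \<in> N \<inter> A" if "s \<in> S" for s
    using that S(2) t' CA N.inv_op_closed2[of t' s] by (auto simp: subset_iff)
  then have "F \<subseteq> N \<inter> A" using we by (auto simp: F_def)
  moreover have "finite F" using S by (simp add: F_def)
  moreover have "v \<in> U"
    if U: "subgroup U G" "F \<subseteq> U" and v: "v \<in> N \<inter> A" and c: "c \<in> C" and eq: "v \<otimes> t \<otimes> c = t'"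
    for U v c
  proof -
    interpret U: subgroup U G by (rule U)
    have vt: "v = t' \<otimes> inv c \<otimes> inv t" unfolding eq[symmetric] using v c t by (simp add: m_assoc)
    have wt: "w = t' \<otimes> inv e \<otimes> inv t" unfolding we(3)[symmetric] using we(1,2) t by (simp add: m_assoc)
    define d where "d = inv c \<otimes> e"
    have dC: "d \<in> C" using c we by (simp add: d_def)
    have vw: "v \<otimes> inv w = t' \<otimes> d \<otimes> inv t'"
      unfolding vt wt d_def using t t' c we(2) by (simp add: inv_mult_group m_assoc cancel_left)
    have "d = inv t' \<otimes> (v \<otimes> inv w) \<otimes> t'"
      unfolding vw using t' dC by (simp add: m_assoc cancel_left)
    then have "d \<in> N" using v we(1) t' by (simp add: N.inv_op_closed1)
    then have "d \<in> generate G S" using dC S by simp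
    then have "t' \<otimes> d \<otimes> inv t' \<in> U"
    proof (rule conjugate_generate_mem[OF U(1), rotated 3])
      show "t' \<in> carrier G" using t' by simp
      show "S \<subseteq> carrier G" using S by auto
      show "t' \<otimes> s \<otimes> inv t' \<in> U" if "s \<in> S" for s
        using that U(2) by (auto simp: F_def)
    qed
    moreover have "w \<in> U" using U(2) by (simp add: F_def)
    ultimately have "v \<otimes> inv w \<otimes> w \<in> U" unfolding vw by simp
    then show ?thesis using v we(1) by (simp add: m_assoc)
  qed
  ultimately show ?thesis by (intro exI[of _ F] conjI allI impI) simp_all
qed

end

section \<open>Half-spaces of the amalgamated product\<close>

text \<open>
  In terms of the tree, \<open>D\<close> is the set of all \<open>g\<close> whose edge \<open>g C\<close> lies on the side of the vertex \<open>B\<close> of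
  the base edge \<open>C\<close>, the base edge included. It plays the role of the set of elements of \<open>C\<close> together
  with those whose normal form starts with a letter from \<open>B\<close>.
\<close>

locale amalgam_half_space = group G for G (structure) +
  fixes A B C D :: "'a set"
  assumes subA: "subgroup A G" and subB: "subgroup B G" and subC: "subgroup C G"
    and CA: "C \<subseteq> A" and CB: "C \<subseteq> B"
    and gen: "generate G (A \<union> B) = carrier G"
    and D_carrier: "D \<subseteq> carrier G" and CD: "C \<subseteq> D"
    and D_B: "g \<in> D \<Longrightarrow> b \<in> B \<Longrightarrow> g \<otimes> b \<in> D"
    and D_A: "g \<in> D - C \<Longrightarrow> a \<in> A \<Longrightarrow> g \<otimes> a \<in> D - C"
    and A_D: "a \<in> A - C \<Longrightarrow> g \<in> D \<Longrightarrow> a \<otimes> g \<notin> D"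
    and B_D: "b \<in> B - C \<Longrightarrow> g \<in> carrier G - D \<Longrightarrow> b \<otimes> g \<in> D - C"
begin

sublocale A: subgroup A G by (rule subA)
sublocale B: subgroup B G by (rule subB)
sublocale C: subgroup C G by (rule subC)

lemma one_D: "\<one> \<in> D"
  using CD by auto

lemma D_inter_A: "a \<in> A \<Longrightarrow> a \<in> D \<Longrightarrow> a \<in> C"
  using A_D[of a \<one>] one_D by auto

lemma B_subset_D: "B \<subseteq> D"
  using D_B[OF one_D] by auto

lemma D_B_iff:
  assumes "g \<in> carrier G" "b \<in> B"
  shows "g \<otimes> b \<in> D \<longleftrightarrow> g \<in> D"
proof
  assume "g \<otimes> b \<in> D"
  then have "(g \<otimes> b) \<otimes> inv b \<in> D" by (rule D_B) (simp add: assms)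
  then show "g \<in> D" using assms by (simp add: m_assoc)
qed (simp add: D_B assms)

lemma D_A_iff:
  assumes "g \<in> carrier G" "a \<in> A"
  shows "g \<otimes> a \<in> D - C \<longleftrightarrow> g \<in> D - C"
proof
  assume "g \<otimes> a \<in> D - C"
  then have "(g \<otimes> a) \<otimes> inv a \<in> D - C" by (rule D_A) (simp add: assms)
  then show "g \<in> D - C" using assms by (simp add: m_assoc)
qed (rule D_A, simp_all add: assms)

text \<open>The half-tree on the side of the vertex \<open>A\<close> is the complement of \<open>D\<close> with the base edge added.\<close>

lemma swap: "amalgam_half_space G B A C (C \<union> (carrier G - D))"
proof
  show "generate G (B \<union> A) = carrier G" using gen by (simp add: Un_commute)
next
  fix g a assume g: "g \<in> C \<union> (carrier G - D)" and a: "a \<in> A"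
  then have gc: "g \<in> carrier G" by auto
  have "g \<notin> D - C" using g by auto
  then have "g \<otimes> a \<notin> D - C" using D_A_iff[OF gc a] by simp
  then show "g \<otimes> a \<in> C \<union> (carrier G - D)" using gc a by auto
next
  fix g b assume g: "g \<in> C \<union> (carrier G - D) - C" and b: "b \<in> B"
  then have "g \<otimes> b \<notin> D" using D_B_iff[of g b] by auto
  then show "g \<otimes> b \<in> C \<union> (carrier G - D) - C" using g b CD by auto
next
  fix b g assume b: "b \<in> B - C" and g: "g \<in> C \<union> (carrier G - D)"
  have "b \<otimes> g \<in> D - C"
  proof (cases "g \<in> C")
    case True
    then have "b \<otimes> g \<in> D" using b CB B_subset_D by blast
    moreover have "b \<otimes> g \<notin> C"
    proof
      assume "b \<otimes> g \<in> C"
      then have "(b \<otimes> g) \<otimes> inv g \<in> C" using True by blast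
      then show False using b True by (simp add: m_assoc)
    qed
    ultimately show ?thesis by simp
  next
    case False
    then show ?thesis using B_D b g by blast
  qed
  then show "b \<otimes> g \<notin> C \<union> (carrier G - D)" by auto
next
  fix a g assume a: "a \<in> A - C" and g: "g \<in> carrier G - (C \<union> (carrier G - D))"
  then have "a \<otimes> g \<notin> D" using A_D[of a g] by auto
  then show "a \<otimes> g \<in> C \<union> (carrier G - D) - C" using a g CD by auto
qed (use subA subB subC CA CB in auto)

lemmas carrier_induct [consumes 1, case_names one step] =
  generate_Un_induct[OF subA subB gen]

subsection \<open>The index of C\<close>

lemma not_finite_index_C:
  assumes "A \<noteq> C" "C \<noteq> B"
  shows "\<not> finite_index G C"
proof
  assume "finite_index G C"
  then obtain T where T: "finite T" "T \<subseteq> carrier G"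
    "\<And>g. g \<in> carrier G \<Longrightarrow> \<exists>h\<in>C. \<exists>t\<in>T. g = h \<otimes> t"
    unfolding finite_index_def using finite_rcosets_iff[OF subC] by blast
  obtain a b where a: "a \<in> A - C" and b: "b \<in> B - C" using assms CA CB by blast
  \<comment> \<open>The powers of \<open>b a\<close> lie in distinct cosets of \<open>C\<close>, as \<open>b a\<close> moves \<open>D\<close> into \<open>D - C\<close>.\<close>
  define p where "p = b \<otimes> a"
  have p: "p \<in> carrier G" using a b by (auto simp: p_def)
  have pow: "p [^] k \<in> D \<and> (k > 0 \<longrightarrow> p [^] k \<notin> C)" for k :: nat
  proof (induction k)
    case 0
    then show ?case using one_D by simp
  next
    case (Suc k)
    have "p [^] Suc k = b \<otimes> (a \<otimes> p [^] k)"
      using nat_pow_Suc2[OF p] a b p by (auto simp: p_def m_assoc)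
    moreover have "a \<otimes> p [^] k \<in> carrier G - D" using A_D[OF a] Suc a p by auto
    ultimately show ?case using B_D[OF b] by auto
  qed
  have "\<exists>t. t \<in> T \<and> (\<exists>h\<in>C. p [^] k = h \<otimes> t)" for k :: nat
    using T(3)[of "p [^] k"] p by blast
  then obtain f where f: "\<And>k::nat. f k \<in> T \<and> (\<exists>h\<in>C. p [^] k = h \<otimes> f k)" by metis
  have "\<not> inj f"
  proof
    assume "inj f"
    then have "infinite (range f)" by (simp add: finite_image_iff)
    moreover have "range f \<subseteq> T" using f by auto
    ultimately show False using T(1) finite_subset by blast
  qed
  then obtain i j where ij: "i < j" "f i = f j"
    unfolding inj_def by (metis linorder_neqE_nat)
  obtain h h' where h: "h \<in> C" "p [^] i = h \<otimes> f i" "h' \<in> C" "p [^] j = h' \<otimes> f i"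
    using f ij by metis
  have t: "f i \<in> carrier G" using f T by blast
  have "p [^] (j - i) \<otimes> p [^] i = p [^] j" using nat_pow_mult[OF p, of "j - i" i] ij by simp
  then have "p [^] (j - i) = p [^] j \<otimes> inv (p [^] i)" using p by (simp add: inv_solve_right)
  also have "\<dots> = h' \<otimes> inv h" using h t by (simp add: inv_mult_group m_assoc cancel_left)
  finally have "p [^] (j - i) \<in> C" using h by simp
  then show False using pow[of "j - i"] ij by simp
qed

subsection \<open>Finitely generated normal subgroups\<close>

text \<open>
  Here \<open>b\<close> stands for an edge at the vertex \<open>B\<close> whose whole \<open>N\<close>-orbit lies in the half-tree \<open>D\<close>. Right
  multiplication by \<open>B\<close> then gives \<open>N \<subseteq> D\<close>. For \<open>n \<notin> C\<close> and \<open>a \<in> A - C\<close> the element \<open>n a b\<close> lies in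
  \<open>D\<close>, but by normality it also lies in \<open>a D\<close>, which is disjoint from \<open>D\<close>.
\<close>

lemma subset_C_of_half:
  assumes N: "N \<lhd> G" and AC: "A \<noteq> C" and b: "b \<in> B" and Nb: "\<And>n. n \<in> N \<Longrightarrow> n \<otimes> b \<in> D"
  shows "N \<subseteq> C"
proof
  interpret N: normal N G by (rule N)
  fix n assume n: "n \<in> N"
  obtain a where a: "a \<in> A - C" using AC CA by blast
  show "n \<in> C"
  proof (rule ccontr)
    assume "n \<notin> C"
    moreover have "n \<in> D" using Nb[OF n] D_B_iff n b by simp
    ultimately have "n \<otimes> a \<in> D - C" using D_A a by auto
    then have "n \<otimes> a \<otimes> b \<in> D" using D_B b by auto
    moreover have "n \<otimes> a \<otimes> b = a \<otimes> (inv a \<otimes> n \<otimes> a \<otimes> b)"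
      using n a b by (simp add: m_assoc cancel_left)
    moreover have "inv a \<otimes> n \<otimes> a \<otimes> b \<in> D"
      using n a by (intro Nb N.inv_op_closed1) auto
    ultimately show False using A_D[OF a] by simp
  qed
qed

lemma half_path_step:
  assumes u: "u \<in> carrier G - C" and l: "l \<in> A \<union> B" and ul: "u \<otimes> l \<notin> C"
  shows "u \<otimes> l \<in> D \<longleftrightarrow> u \<in> D"
  using D_A_iff[of u l] D_B_iff[of u l] assms by blast

text \<open>A path that avoids the edge \<open>x C\<close> does not change sides with respect to it.\<close>

lemma half_path:
  assumes X: "X \<subseteq> carrier G" and x: "x \<in> carrier G" and xC: "\<And>c. c \<in> C \<Longrightarrow> x \<otimes> c \<notin> X"
    and path: "(g, h) \<in> (path_step G (A \<union> B) X)\<^sup>*"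
  shows "inv x \<otimes> h \<in> D \<longleftrightarrow> inv x \<otimes> g \<in> D"
  using path
proof (induction rule: rtrancl_induct)
  case base
  then show ?case by simp
next
  case (step h k)
  then have hk: "h \<in> X" "k \<in> X" "inv h \<otimes> k \<in> A \<union> B" unfolding path_step_def by auto
  have hk': "h \<in> carrier G" "k \<in> carrier G" using hk X by auto
  have notC: "inv x \<otimes> y \<notin> C" if "y \<in> X" for y
  proof
    assume "inv x \<otimes> y \<in> C"
    from xC[OF this] show False using that X x by (simp add: m_assoc[symmetric] subset_iff)
  qed
  have "(inv x \<otimes> h) \<otimes> (inv h \<otimes> k) = inv x \<otimes> k"
    using hk' x by (simp add: m_assoc cancel_left)
  then have "inv x \<otimes> k \<in> D \<longleftrightarrow> inv x \<otimes> h \<in> D"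
    using half_path_step[of "inv x \<otimes> h" "inv h \<otimes> k"] notC hk hk' x by auto
  then show ?case using step.IH by simp
qed

text \<open>
  The key step for finite index: a connected \<open>N\<close>-invariant set \<open>X\<close> of edges that can be left through
  a vertex \<open>y B\<close> exists only if \<open>N \<subseteq> C\<close>. With \<open>x = y b\<close> outside \<open>X\<close>, all of \<open>X\<close> is on the side of \<open>x C\<close>
  that contains \<open>y\<close>; translated by \<open>inv x\<close> this puts \<open>N (inv b)\<close> into \<open>D\<close>.
\<close>

lemma subset_C_of_exit:
  assumes N: "N \<lhd> G" and AC: "A \<noteq> C" and X: "X \<subseteq> carrier G"
    and NX: "\<And>n x. n \<in> N \<Longrightarrow> x \<in> X \<Longrightarrow> n \<otimes> x \<in> X"
    and XC: "\<And>c x. x \<in> X \<Longrightarrow> c \<in> C \<Longrightarrow> x \<otimes> c \<in> X"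
    and conn: "\<And>x. x \<in> X \<Longrightarrow> (\<one>, x) \<in> (path_step G (A \<union> B) X)\<^sup>*"
    and y: "y \<in> X" and b: "b \<in> B" and yb: "y \<otimes> b \<notin> X"
  shows "N \<subseteq> C"
proof -
  interpret N: normal N G by (rule N)
  define x where "x = y \<otimes> b"
  have yc: "y \<in> carrier G" using X y by auto
  have x: "x \<in> carrier G" using yc b by (simp add: x_def)
  have xC: "x \<otimes> c \<notin> X" if c: "c \<in> C" for c
  proof
    assume "x \<otimes> c \<in> X"
    then have "x \<otimes> c \<otimes> inv c \<in> X" using XC c by blast
    then show False using x c yb by (simp add: m_assoc x_def)
  qed
  have xy: "inv x \<otimes> y = inv b" using yc b by (simp add: x_def inv_mult_group m_assoc)
  then have "inv x \<otimes> y \<in> D" using b B_subset_D by auto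
  then have D: "inv x \<otimes> h \<in> D" if "h \<in> X" for h
    using half_path[OF X x xC conn[OF that]] half_path[OF X x xC conn[OF y]] by simp
  have "n \<otimes> inv b \<in> D" if n: "n \<in> N" for n
  proof -
    have "inv x \<otimes> ((x \<otimes> n \<otimes> inv x) \<otimes> y) \<in> D"
      using n x y by (intro D NX N.inv_op_closed2)
    also have "inv x \<otimes> ((x \<otimes> n \<otimes> inv x) \<otimes> y) = n \<otimes> (inv x \<otimes> y)"
      using n x yc by (simp add: m_assoc cancel_left)
    finally show ?thesis using xy by simp
  qed
  then show ?thesis using subset_C_of_half[OF N AC, of "inv b"] b by simp
qed

text \<open>The set \<open>Y\<close> is the set of prefixes of a word for \<open>g\<close> in the letters \<open>A \<union> B\<close>.\<close>

lemma finite_path: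
  assumes "g \<in> carrier G"
  shows "\<exists>Y. finite Y \<and> Y \<subseteq> carrier G \<and> g \<in> Y \<and>
    (\<forall>X. Y \<subseteq> X \<longrightarrow> (\<forall>y\<in>Y. (\<one>, y) \<in> (path_step G (A \<union> B) X)\<^sup>*))"
  using assms
proof (induction rule: carrier_induct)
  case one
  show ?case by (intro exI[of _ "{\<one>}"]) auto
next
  case (step g x)
  from step.IH obtain Y where Y: "finite Y" "Y \<subseteq> carrier G" "g \<in> Y"
    "\<forall>X. Y \<subseteq> X \<longrightarrow> (\<forall>y\<in>Y. (\<one>, y) \<in> (path_step G (A \<union> B) X)\<^sup>*)"
    by (elim exE conjE) (rule that)
  have xc: "x \<in> carrier G" using step.hyps by auto
  have "(\<one>, y) \<in> (path_step G (A \<union> B) X)\<^sup>*"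
    if X: "insert (g \<otimes> x) Y \<subseteq> X" and y: "y \<in> insert (g \<otimes> x) Y" for X y
  proof -
    have YX: "(\<one>, y) \<in> (path_step G (A \<union> B) X)\<^sup>*" if "y \<in> Y" for y
      using Y(4)[rule_format, of X y] X that by simp
    have "inv g \<otimes> (g \<otimes> x) = x" using step.hyps xc by (simp add: cancel_left)
    then have "(g, g \<otimes> x) \<in> path_step G (A \<union> B) X"
      using X Y(3) step.hyps by (simp add: path_step_def subset_iff)
    then have "(\<one>, g \<otimes> x) \<in> (path_step G (A \<union> B) X)\<^sup>*"
      by (rule rtrancl_into_rtrancl[OF YX[OF Y(3)]])
    then show ?thesis using y YX by (elim insertE) simp_all
  qed
  moreover have "finite (insert (g \<otimes> x) Y)" "insert (g \<otimes> x) Y \<subseteq> carrier G"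
    using Y(1,2) step.hyps xc by simp_all
  ultimately show ?case by (intro exI[of _ "insert (g \<otimes> x) Y"] conjI allI impI ballI) simp_all
qed

lemma finite_index_of_finitely_generated:
  assumes N: "N \<lhd> G" and fg: "finitely_generated_subgroup G N" and NC: "\<not> N \<subseteq> C"
    and AC: "A \<noteq> C" and CB: "C \<noteq> B"
  shows "finite_index G (N <#> C)"
proof -
  interpret N: normal N G by (rule N)
  obtain S where S: "finite S" "S \<subseteq> N" "generate G S = N"
    using fg unfolding finitely_generated_subgroup_def by blast
  have "\<forall>s\<in>S. \<exists>Y. finite Y \<and> Y \<subseteq> carrier G \<and> s \<in> Y \<and>
    (\<forall>X. Y \<subseteq> X \<longrightarrow> (\<forall>y\<in>Y. (\<one>, y) \<in> (path_step G (A \<union> B) X)\<^sup>*))"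
    using S(2) by (intro ballI finite_path) auto
  from bchoice[OF this] obtain Y where Y: "\<forall>s\<in>S. finite (Y s) \<and> Y s \<subseteq> carrier G \<and> s \<in> Y s \<and>
    (\<forall>X. Y s \<subseteq> X \<longrightarrow> (\<forall>y\<in>Y s. (\<one>, y) \<in> (path_step G (A \<union> B) X)\<^sup>*))"
    by (elim exE) (rule that)
  define Z where "Z = insert \<one> (\<Union>s\<in>S. Y s)"
  have Z: "finite Z" "Z \<subseteq> carrier G" using S Y by (auto simp: Z_def)
  \<comment> \<open>\<open>Z\<close> contains a path from \<open>1\<close> to each generator, so its \<open>N\<close>-orbit is connected.\<close>
  define X where "X = {n \<otimes> z \<otimes> c | n z c. n \<in> N \<and> z \<in> Z \<and> c \<in> C}"
  let ?r = "path_step G (A \<union> B) X"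
  have X: "X \<subseteq> carrier G" using Z by (auto simp: X_def)
  have XI: "n \<otimes> z \<otimes> c \<in> X" if "n \<in> N" "z \<in> Z" "c \<in> C" for n z c
    using that by (auto simp: X_def)
  have ZX: "Z \<subseteq> X" using XI[of \<one> _ \<one>] Z by force
  have NX: "m \<otimes> x \<in> X" if m: "m \<in> N" and x: "x \<in> X" for m x
  proof -
    obtain n z c where nzc: "n \<in> N" "z \<in> Z" "c \<in> C" "x = n \<otimes> z \<otimes> c"
      using x by (auto simp: X_def)
    then have "m \<otimes> x = (m \<otimes> n) \<otimes> z \<otimes> c" using m Z by (simp add: m_assoc subset_iff)
    then show ?thesis using XI nzc m by simp
  qed
  have XC: "x \<otimes> d \<in> X" if x: "x \<in> X" and d: "d \<in> C" for x d
  proof -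
    obtain n z c where nzc: "n \<in> N" "z \<in> Z" "c \<in> C" "x = n \<otimes> z \<otimes> c"
      using x by (auto simp: X_def)
    then have "x \<otimes> d = n \<otimes> z \<otimes> (c \<otimes> d)" using d Z by (simp add: m_assoc subset_iff)
    then show ?thesis using XI nzc d by simp
  qed
  have reach_Z: "(\<one>, z) \<in> ?r\<^sup>*" if z: "z \<in> Z" for z
  proof (cases "z = \<one>")
    case False
    then obtain s where s: "s \<in> S" "z \<in> Y s" using z by (auto simp: Z_def)
    then have "Y s \<subseteq> X" using ZX by (auto simp: Z_def)
    then show ?thesis using bspec[OF Y s(1)] s(2) by simp
  qed simp
  have symr: "sym ?r"
  proof (rule symI)
    fix g h assume gh: "(g, h) \<in> ?r"
    then have c: "g \<in> carrier G" "h \<in> carrier G" and "inv g \<otimes> h \<in> A \<union> B"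
      using X by (auto simp: path_step_def)
    then have "inv (inv g \<otimes> h) \<in> A \<union> B" by auto
    then have "inv h \<otimes> g \<in> A \<union> B" using c by (simp add: inv_mult_group)
    then show "(h, g) \<in> ?r" using gh by (auto simp: path_step_def)
  qed
  have invr: "(n \<otimes> g, n \<otimes> h) \<in> ?r" if n: "n \<in> N" and gh: "(g, h) \<in> ?r" for n g h
  proof -
    have c: "g \<in> carrier G" "h \<in> carrier G" using gh X by (auto simp: path_step_def)
    have "inv (n \<otimes> g) \<otimes> (n \<otimes> h) = inv g \<otimes> h"
      using c n by (simp add: inv_mult_group m_assoc cancel_left)
    then show ?thesis using gh n NX by (auto simp: path_step_def)
  qed
  have tr: "(n \<otimes> g, n \<otimes> h) \<in> ?r\<^sup>*" if "n \<in> N" "(g, h) \<in> ?r\<^sup>*" for n g h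
    by (rule rtrancl_image[where f = "\<lambda>x. n \<otimes> x", OF _ that(2)]) (rule invr[OF that(1)])
  have reach_N: "(\<one>, n) \<in> ?r\<^sup>*" if "n \<in> N" for n
  proof (rule generate_reachable[OF N.is_subgroup S(2) symr invr])
    show "(\<one>, s) \<in> ?r\<^sup>*" if "s \<in> S" for s
      using that Y by (intro reach_Z) (auto simp: Z_def)
    show "n \<in> generate G S" using S that by simp
  qed
  have conn: "(\<one>, x) \<in> ?r\<^sup>*" if x: "x \<in> X" for x
  proof -
    obtain n z c where nzc: "n \<in> N" "z \<in> Z" "c \<in> C" "x = n \<otimes> z \<otimes> c"
      using x by (auto simp: X_def)
    have zc: "z \<in> carrier G" using nzc Z by auto
    have "(\<one>, n) \<in> ?r\<^sup>*" using reach_N nzc by simp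
    also have "(n, n \<otimes> z) \<in> ?r\<^sup>*" using tr[OF nzc(1) reach_Z[OF nzc(2)]] nzc by simp
    also have "(n \<otimes> z, x) \<in> ?r"
    proof -
      have "inv (n \<otimes> z) \<otimes> x = c" using nzc zc cancel_left(1)[of "n \<otimes> z" c] by simp
      then show ?thesis using nzc x XI[of n z \<one>] zc CA by (auto simp: path_step_def)
    qed
    finally show ?thesis .
  qed
  have all: "g \<in> X" if "g \<in> carrier G" for g
    using that
  proof (induction rule: carrier_induct)
    case one
    then show ?case using ZX by (auto simp: Z_def)
  next
    case (step g x)
    show ?case
    proof (rule ccontr)
      assume out: "g \<otimes> x \<notin> X"
      have "N \<subseteq> C"
      proof (cases "x \<in> B")
        case True
        show ?thesis by (rule subset_C_of_exit[OF N AC X NX XC conn step.IH True out])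
      next
        case False
        then have xA: "x \<in> A" using step by simp
        interpret sw: amalgam_half_space G B A C "C \<union> (carrier G - D)" by (rule swap)
        show ?thesis
          by (rule sw.subset_C_of_exit[OF N CB[symmetric] X NX XC _ step.IH xA out])
            (simp_all add: conn Un_commute)
      qed
      then show False using NC by simp
    qed
  qed
  have "\<exists>n\<in>N. \<exists>z\<in>Z. \<exists>c\<in>C. g = n \<otimes> z \<otimes> c" if "g \<in> carrier G" for g
    using all[OF that] unfolding X_def by blast
  then show ?thesis
    unfolding finite_index_mult_normal_iff[OF N subC]
    using Z by (intro exI[of _ Z] conjI ballI)
qed

subsection \<open>Finite generation of the factors\<close>

text \<open>
  \<open>P D\<close> is the set of edges whose branch at the vertex \<open>A\<close> starts with an edge from \<open>P\<close>. In the tree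
  this set can be left only at the vertex \<open>A\<close> itself, where adjacency after splitting respects \<open>P\<close> by
  the separation assumption \<open>sep\<close>.
\<close>

lemma split_step_closed:
  assumes NS: "subgroup N G" and P: "P \<subseteq> A" and PC: "\<And>p c. p \<in> P \<Longrightarrow> c \<in> C \<Longrightarrow> p \<otimes> c \<in> P"
    and sep: "\<And>v p q. v \<in> N \<inter> A \<Longrightarrow> p \<in> P \<Longrightarrow> v \<otimes> p \<in> P \<Longrightarrow> q \<in> P \<Longrightarrow> v \<otimes> q \<in> P"
    and gh: "(g, h) \<in> split_step G N A B P"
    and g: "\<exists>p\<in>P. \<exists>w\<in>D. g = p \<otimes> w"
  shows "\<exists>p\<in>P. \<exists>w\<in>D. h = p \<otimes> w"
proof -
  interpret N: subgroup N G by (rule NS)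
  obtain p w where pw: "p \<in> P" "w \<in> D" "g = p \<otimes> w" using g by blast
  have c: "g \<in> carrier G" "h \<in> carrier G" "p \<in> A" "w \<in> carrier G"
    using gh pw P D_carrier by (auto simp: split_step_def)
  define x where "x = inv g \<otimes> h"
  have xG: "x \<in> carrier G" using c by (simp add: x_def)
  have h: "h = g \<otimes> x" using c by (simp add: x_def cancel_left)
  have hx: "h = p \<otimes> (w \<otimes> x)" using h pw c xG by (simp add: m_assoc)
  have step: "x \<in> B \<or> x \<in> A \<and>
      (g \<notin> N <#> A \<or> (\<exists>n\<in>N. \<exists>p\<in>P. \<exists>q\<in>P. g = n \<otimes> p \<and> h = n \<otimes> q))"
    using gh unfolding split_step_def x_def by simp
  show ?thesis
  proof (cases "x \<in> B \<or> g \<notin> A")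
    case True
    have "w \<otimes> x \<in> D"
    proof (cases "x \<in> B")
      case True
      then show ?thesis using D_B pw by simp
    next
      case False
      then have "x \<in> A" "g \<notin> A" using step \<open>x \<in> B \<or> g \<notin> A\<close> by simp_all
      moreover have "w \<notin> C" using \<open>g \<notin> A\<close> pw c CA by auto
      ultimately show ?thesis using D_A[of w x] pw by simp
    qed
    then show ?thesis using hx pw(1) by (intro bexI)
  next
    case False
    then have gA: "g \<in> A" by simp
    \<comment> \<open>The step takes place at the vertex \<open>A\<close>, so \<open>w\<close> is in \<open>A \<inter> D = C\<close> and \<open>g\<close> is in \<open>P\<close>.\<close>
    have "\<one> \<otimes> g \<in> N <#> A" unfolding set_mult_def using N.one_closed gA by blast
    then have "g \<in> N <#> A" using c by simp
    then have "\<exists>n\<in>N. \<exists>p\<in>P. \<exists>q\<in>P. g = n \<otimes> p \<and> h = n \<otimes> q" using step False by simp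
    then obtain n r q where nrq: "n \<in> N" "r \<in> P" "q \<in> P" "g = n \<otimes> r" "h = n \<otimes> q"
      by (elim bexE conjE) (rule that)
    have "w = inv p \<otimes> g" using pw c by (simp add: cancel_left)
    then have "w \<in> A" using gA c by simp
    then have "w \<in> C" using D_inter_A pw by simp
    then have gP: "g \<in> P" using PC pw by simp
    have rA: "r \<in> A" using nrq P by auto
    have "g \<otimes> inv r \<in> A" using gA rA by simp
    also have "g \<otimes> inv r = n" using nrq rA by (simp add: m_assoc)
    finally have "h \<in> P" using sep[of n r q] nrq gP by simp
    moreover have "h = h \<otimes> \<one>" using c by simp
    ultimately show ?thesis using one_D by (intro bexI)
  qed
qed

text \<open>
  \<open>R\<close> represents the finitely many \<open>(N \<inter> A)\<close>-orbits of edges at the vertex \<open>A\<close>, and \<open>P U\<close> consists of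
  the edges of one piece of that vertex when it is split according to the cosets of \<open>U\<close>. The
  generators of \<open>U\<close> are of two kinds: those from \<open>L\<close> make distinct pieces disjoint (\<open>sep\<close>), and
  those from \<open>Q\<close> keep \<open>1\<close> connected to the generators of \<open>N\<close> after splitting (\<open>path\<close>).
\<close>

lemma finitely_generated_inter_A:
  assumes N: "N \<lhd> G" and fgN: "finitely_generated_subgroup G N"
    and fgC: "finitely_generated_subgroup G (N \<inter> C)" and fin: "finite_index G (N <#> C)"
  shows "finitely_generated_subgroup G (N \<inter> A)"
proof -
  interpret N: normal N G by (rule N)
  have VS: "subgroup (N \<inter> A) G" by (rule subgroups_Inter_pair[OF N.is_subgroup subA])
  obtain S where S: "finite S" "S \<subseteq> N" "generate G S = N"
    using fgN unfolding finitely_generated_subgroup_def by blast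
  obtain T where T: "finite T" "T \<subseteq> carrier G"
    "\<forall>g\<in>carrier G. \<exists>n\<in>N. \<exists>t\<in>T. \<exists>c\<in>C. g = n \<otimes> t \<otimes> c"
    using fin unfolding finite_index_mult_normal_iff[OF N subC] by (elim exE conjE) (rule that)
  obtain R where R: "finite R" "R \<subseteq> A" "\<one> \<in> R"
    "\<forall>x\<in>A. \<exists>v\<in>N \<inter> A. \<exists>t\<in>R. \<exists>c\<in>C. x = v \<otimes> t \<otimes> c"
    by (rule finite_double_coset_representatives[OF N subA subC CA T]) (rule that)
  have "\<forall>z\<in>R \<times> R. \<exists>F. finite F \<and> F \<subseteq> N \<inter> A \<and> (\<forall>U v c. subgroup U G \<longrightarrow> F \<subseteq> U \<longrightarrow>
    v \<in> N \<inter> A \<longrightarrow> c \<in> C \<longrightarrow> v \<otimes> fst z \<otimes> c = snd z \<longrightarrow> v \<in> U)"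
    using R(2) by (intro ballI finite_linking_set[OF N subA subC CA fgC]) auto
  from bchoice[OF this] obtain L where L: "\<forall>z\<in>R \<times> R. finite (L z) \<and> L z \<subseteq> N \<inter> A \<and>
    (\<forall>U v c. subgroup U G \<longrightarrow> L z \<subseteq> U \<longrightarrow>
      v \<in> N \<inter> A \<longrightarrow> c \<in> C \<longrightarrow> v \<otimes> fst z \<otimes> c = snd z \<longrightarrow> v \<in> U)"
    by (elim exE) (rule that)
  define P where "P U = {u \<otimes> t \<otimes> c | u t c. u \<in> U \<and> t \<in> R \<and> c \<in> C}" for U
  have PI: "u \<otimes> t \<otimes> c \<in> P U" if "u \<in> U" "t \<in> R" "c \<in> C" for u t c U
    using that by (auto simp: P_def)
  have path: "\<exists>F. finite F \<and> F \<subseteq> N \<inter> A \<and>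
    (\<forall>U. subgroup U G \<longrightarrow> F \<subseteq> U \<longrightarrow> (\<one>, g) \<in> (split_step G N A B (P U))\<^sup>*)"
    if "g \<in> carrier G" for g
    using that
  proof (induction rule: carrier_induct)
    case one
    show ?case by (intro exI[of _ "{}"]) simp
  next
    case (step g x)
    from step.IH obtain F where F: "finite F" "F \<subseteq> N \<inter> A"
      "\<forall>U. subgroup U G \<longrightarrow> F \<subseteq> U \<longrightarrow> (\<one>, g) \<in> (split_step G N A B (P U))\<^sup>*"
      by (elim exE conjE) (rule that)
    have xG: "x \<in> carrier G" using step.hyps by auto
    have gx: "inv g \<otimes> (g \<otimes> x) = x" using step.hyps xG by (simp add: cancel_left)
    show ?case
    proof (cases "x \<in> A \<and> g \<in> N <#> A")
      case False
      then have "(g, g \<otimes> x) \<in> split_step G N A B (P U)" for U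
        using step.hyps xG gx by (auto simp: split_step_def)
      then have "(\<one>, g \<otimes> x) \<in> (split_step G N A B (P U))\<^sup>*"
        if "subgroup U G" "F \<subseteq> U" for U
        using rtrancl_into_rtrancl F(3) that by metis
      then show ?thesis using F(1,2) by (intro exI[of _ F] conjI allI impI)
    next
      case True
      then obtain n y where ny: "n \<in> N" "y \<in> A" "g = n \<otimes> y" unfolding set_mult_def by blast
      obtain v t c where vtc: "v \<in> N \<inter> A" "t \<in> R" "c \<in> C" "y = v \<otimes> t \<otimes> c"
        using bspec[OF R(4) ny(2)] by (elim bexE) (rule that)
      have tA: "t \<in> A" and cA: "c \<in> A" using vtc R(2) CA by auto
      have xA: "x \<in> A" using True by simp
      then have tcx: "t \<otimes> c \<otimes> x \<in> A" using tA cA by simp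
      obtain v' t' c' where vtc': "v' \<in> N \<inter> A" "t' \<in> R" "c' \<in> C"
        "t \<otimes> c \<otimes> x = v' \<otimes> t' \<otimes> c'"
        using bspec[OF R(4) tcx] by (elim bexE) (rule that)
      have nv: "n \<otimes> v \<in> N" using ny vtc by simp
      have 1: "g = (n \<otimes> v) \<otimes> (\<one> \<otimes> t \<otimes> c)" using ny vtc tA cA by (simp add: m_assoc)
      have "g \<otimes> x = (n \<otimes> v) \<otimes> (t \<otimes> c \<otimes> x)" using ny vtc tA cA xG by (simp add: m_assoc)
      then have 2: "g \<otimes> x = (n \<otimes> v) \<otimes> (v' \<otimes> t' \<otimes> c')" using vtc'(4) by simp
      have "(\<one>, g \<otimes> x) \<in> (split_step G N A B (P U))\<^sup>*"
        if U: "subgroup U G" "insert v' F \<subseteq> U" for U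
      proof -
        have "\<one> \<otimes> t \<otimes> c \<in> P U" using vtc subgroup.one_closed[OF U(1)] by (intro PI)
        moreover have "v' \<otimes> t' \<otimes> c' \<in> P U" using vtc' U(2) by (intro PI) auto
        ultimately have "\<exists>n\<in>N. \<exists>p\<in>P U. \<exists>q\<in>P U. g = n \<otimes> p \<and> g \<otimes> x = n \<otimes> q"
          using nv 1 2 by (intro bexI conjI)
        then have "(g, g \<otimes> x) \<in> split_step G N A B (P U)"
          using step.hyps(1) xG gx xA by (simp add: split_step_def)
        moreover have "(\<one>, g) \<in> (split_step G N A B (P U))\<^sup>*" using F(3) U by simp
        ultimately show ?thesis by (rule rtrancl_into_rtrancl[rotated])
      qed
      then show ?thesis
        using F(1,2) vtc'(1) by (intro exI[of _ "insert v' F"] conjI allI impI) simp_all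
    qed
  qed
  have "\<forall>s\<in>S. \<exists>F. finite F \<and> F \<subseteq> N \<inter> A \<and>
    (\<forall>U. subgroup U G \<longrightarrow> F \<subseteq> U \<longrightarrow> (\<one>, s) \<in> (split_step G N A B (P U))\<^sup>*)"
    using S(2) by (intro ballI path) auto
  from bchoice[OF this] obtain Q where Q: "\<forall>s\<in>S. finite (Q s) \<and> Q s \<subseteq> N \<inter> A \<and>
    (\<forall>U. subgroup U G \<longrightarrow> Q s \<subseteq> U \<longrightarrow> (\<one>, s) \<in> (split_step G N A B (P U))\<^sup>*)"
    by (elim exE) (rule that)
  define F where "F = (\<Union>z\<in>R \<times> R. L z) \<union> (\<Union>s\<in>S. Q s)"
  have "finite (\<Union>z\<in>R \<times> R. L z)" using R(1) L by (intro finite_UN_I) auto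
  moreover have "finite (\<Union>s\<in>S. Q s)" using S(1) Q by (intro finite_UN_I) auto
  ultimately have F1: "finite F" by (simp add: F_def)
  have "(\<Union>z\<in>R \<times> R. L z) \<subseteq> N \<inter> A" by (intro UN_least) (rule bspec[OF L, THEN conjunct2, THEN conjunct1])
  moreover have "(\<Union>s\<in>S. Q s) \<subseteq> N \<inter> A" by (intro UN_least) (rule bspec[OF Q, THEN conjunct2, THEN conjunct1])
  ultimately have F2: "F \<subseteq> N \<inter> A" by (simp add: F_def)
  define U where "U = generate G F"
  have FU: "F \<subseteq> U" by (auto simp: U_def intro: generate.incl)
  have US: "subgroup U G"
    unfolding U_def by (rule generate_is_subgroup) (use F2 in auto)
  interpret U: subgroup U G by (rule US)
  have UV: "U \<subseteq> N \<inter> A" unfolding U_def by (rule generate_subgroup_incl[OF F2 VS])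
  have PA: "P U \<subseteq> A"
  proof
    fix p assume "p \<in> P U"
    then obtain u t c where "u \<in> U" "t \<in> R" "c \<in> C" "p = u \<otimes> t \<otimes> c" by (auto simp: P_def)
    then show "p \<in> A" using UV R(2) CA by (simp add: subset_iff)
  qed
  have PC: "p \<otimes> d \<in> P U" if p: "p \<in> P U" and d: "d \<in> C" for p d
  proof -
    obtain u t c where utc: "u \<in> U" "t \<in> R" "c \<in> C" "p = u \<otimes> t \<otimes> c" using p by (auto simp: P_def)
    have "t \<in> carrier G" using utc R(2) by auto
    then have "p \<otimes> d = u \<otimes> t \<otimes> (c \<otimes> d)" using utc d by (simp add: m_assoc)
    then show ?thesis using PI utc d by simp
  qed
  have sep: "v \<in> U" if v: "v \<in> N \<inter> A" and p: "p \<in> P U" and vp: "v \<otimes> p \<in> P U" for v p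
  proof -
    obtain u t c where utc: "u \<in> U" "t \<in> R" "c \<in> C" "p = u \<otimes> t \<otimes> c"
      using p by (auto simp: P_def)
    obtain u' t' c' where utc': "u' \<in> U" "t' \<in> R" "c' \<in> C" "v \<otimes> p = u' \<otimes> t' \<otimes> c'"
      using vp by (auto simp: P_def)
    have tG: "t \<in> carrier G" "t' \<in> carrier G" using utc utc' R(2) by auto
    \<comment> \<open>Both \<open>u\<close> and \<open>u'\<close> are in \<open>U\<close>, so it suffices to show that \<open>w\<close> is; it carries \<open>t C\<close> to \<open>t' C\<close>.\<close>
    define w where "w = inv u' \<otimes> v \<otimes> u"
    have w: "w \<in> N \<inter> A" using utc utc' v UV by (simp add: w_def subset_iff)
    have "w \<otimes> t \<otimes> (c \<otimes> inv c') = inv u' \<otimes> (v \<otimes> p) \<otimes> inv c'"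
      using utc utc'(1-3) tG v by (simp add: w_def m_assoc)
    also have "\<dots> = t'" unfolding utc'(4) using utc'(1-3) tG by (simp add: m_assoc cancel_left)
    finally have eq: "w \<otimes> t \<otimes> (c \<otimes> inv c') = t'" .
    have z: "(t, t') \<in> R \<times> R" using utc utc' by simp
    have "L (t, t') \<subseteq> U" using z FU unfolding F_def by blast
    then have "w \<in> U"
      using bspec[OF L z] US w eq C.m_closed[OF utc(3) C.m_inv_closed[OF utc'(3)]]
      by (elim conjE) (simp only: fst_conv snd_conv)
    then have "u' \<otimes> w \<otimes> inv u \<in> U" using utc utc' by simp
    also have "u' \<otimes> w \<otimes> inv u = v" using utc utc' v by (simp add: w_def m_assoc cancel_left)
    finally show ?thesis .
  qed
  have UP: "v \<otimes> q \<in> P U" if v: "v \<in> U" and q: "q \<in> P U" for v q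
  proof -
    obtain u t c where utc: "u \<in> U" "t \<in> R" "c \<in> C" "q = u \<otimes> t \<otimes> c"
      using q by (auto simp: P_def)
    have "t \<in> carrier G" using utc R(2) by auto
    then have "v \<otimes> q = (v \<otimes> u) \<otimes> t \<otimes> c" using utc v by (simp add: m_assoc)
    then show ?thesis using PI utc v by simp
  qed
  have oneP: "\<one> \<in> P U" using PI[of \<one> U \<one> \<one>] R(3) by simp
  let ?r = "split_step G N A B (P U)"
  have reach: "(\<one>, n) \<in> ?r\<^sup>*" if n: "n \<in> N" for n
  proof (rule generate_reachable[OF N.is_subgroup S(2)])
    show "sym ?r" by (rule sym_split_step[OF N.is_subgroup subA subB])
    show "(m \<otimes> g, m \<otimes> h) \<in> ?r" if "m \<in> N" "(g, h) \<in> ?r" for m g h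
      by (rule split_step_translate[OF N.is_subgroup subA subset_trans[OF PA A.subset] that])
    show "(\<one>, s) \<in> ?r\<^sup>*" if s: "s \<in> S" for s
    proof -
      have "Q s \<subseteq> U" using s FU unfolding F_def by blast
      then show ?thesis using bspec[OF Q s] US by simp
    qed
    show "n \<in> generate G S" using S n by simp
  qed
  have half: "\<exists>p\<in>P U. \<exists>w\<in>D. h = p \<otimes> w" if "(\<one>, h) \<in> ?r\<^sup>*" for h
    using that
  proof (induction rule: rtrancl_induct)
    case base
    have "\<one> = \<one> \<otimes> \<one>" by simp
    then show ?case using oneP one_D by (intro bexI)
  next
    case (step g h)
    have sep': "v \<otimes> q \<in> P U" if "v \<in> N \<inter> A" "p \<in> P U" "v \<otimes> p \<in> P U" "q \<in> P U" for v p q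
      by (rule UP[OF sep[OF that(1-3)] that(4)])
    show ?case
      by (rule split_step_closed[OF N.is_subgroup PA PC sep' step.hyps(2) step.IH])
  qed
  have "N \<inter> A \<subseteq> U"
  proof
    fix v assume v: "v \<in> N \<inter> A"
    then have vN: "v \<in> N" by simp
    obtain p w where pw: "p \<in> P U" "w \<in> D" "v = p \<otimes> w"
      using half[OF reach[OF vN]] by (elim bexE) (rule that)
    have pA: "p \<in> A" using pw PA by auto
    have "w \<in> carrier G" using pw(2) D_carrier by auto
    then have "inv p \<otimes> v = w" using pw(3) pA by (simp add: cancel_left)
    moreover have "inv p \<otimes> v \<in> A" using pA v by simp
    ultimately have "w \<in> A" by (simp only:)
    then have "w \<in> C" using pw(2) by (rule D_inter_A)
    then have "v \<in> P U" unfolding pw(3) by (rule PC[OF pw(1)])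
    moreover have "v \<otimes> \<one> = v" using v by simp
    ultimately have "v \<otimes> \<one> \<in> P U" by (simp only:)
    then show "v \<in> U" by (rule sep[OF v oneP])
  qed
  then show ?thesis
    unfolding U_def by (rule finitely_generated_subgroupI[OF VS F1 F2])
qed

end

section \<open>Existence of the half-space\<close>

text \<open>The universal property of the internal decomposition \<open>G = A *\<^sub>C B\<close>.\<close>

lemma amalg_decomposition_extend:
  assumes G: "group G" and dec: "is_amalg_decomposition G A B C" and H: "group H"
    and h: "h \<in> hom (G\<lparr>carrier := A\<rparr>) H" and k: "k \<in> hom (G\<lparr>carrier := B\<rparr>) H"
    and agree: "\<And>c. c \<in> C \<Longrightarrow> h c = k c"
  obtains \<Phi> where "\<Phi> \<in> hom G H" "\<And>a. a \<in> A \<Longrightarrow> \<Phi> a = h a" "\<And>b. b \<in> B \<Longrightarrow> \<Phi> b = k b"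
proof -
  interpret G: group G by (rule G)
  have sub: "subgroup A G" "subgroup B G" "subgroup C G" "C \<subseteq> A" "C \<subseteq> B"
    using dec by (simp_all add: is_amalg_decomposition_def)
  let ?A = "G\<lparr>carrier := A\<rparr>" and ?B = "G\<lparr>carrier := B\<rparr>" and ?C = "G\<lparr>carrier := C\<rparr>"
  interpret amalgam ?A ?B ?C "\<lambda>x. x" "\<lambda>x. x"
    using sub G.subgroup_imp_group by (intro amalgam.intro amalgam_axioms.intro) auto
  let ?\<theta> = "amalg_lift G (\<lambda>x. x) (\<lambda>x. x)"
  have incl: "(\<lambda>x. x) \<in> hom ?A G" "(\<lambda>x. x) \<in> hom ?B G"
    using sub by (auto simp: hom_def dest: subgroup.mem_carrier)
  have iso: "?\<theta> \<in> iso P G" using dec by (simp add: is_amalg_decomposition_def)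
  let ?\<psi> = "inv_into (carrier P) ?\<theta>"
  have inj: "inj_on ?\<theta> (carrier P)" using iso by (simp add: iso_def bij_betw_def)
  have \<psi>: "?\<psi> \<in> hom G P"
    using group.iso_set_sym[OF group_amalg iso] by (simp add: iso_def)
  have \<Psi>: "amalg_lift H h k \<in> hom P H"
    using amalg_lift_hom[OF H h k] agree by simp
  have "amalg_lift H h k \<circ> ?\<psi> \<in> hom G H"
    by (rule hom_compose[OF \<psi> \<Psi>])
  moreover have "(amalg_lift H h k \<circ> ?\<psi>) a = h a" if a: "a \<in> A" for a
  proof -
    have aA: "a \<in> carrier ?A" using a by simp
    have "?\<theta> (R `` {[Inl a]}) = a" using amalg_lift_inl[OF G incl _ aA] by simp
    then have "?\<psi> a = R `` {[Inl a]}"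
      using inv_into_f_f[OF inj class_closed[OF inl_word[OF aA]]] by simp
    then show ?thesis using amalg_lift_inl[OF H h k _ aA] agree by simp
  qed
  moreover have "(amalg_lift H h k \<circ> ?\<psi>) b = k b" if b: "b \<in> B" for b
  proof -
    have bB: "b \<in> carrier ?B" using b by simp
    have "?\<theta> (R `` {[Inr b]}) = b" using amalg_lift_inr[OF G incl _ bB] by simp
    then have "?\<psi> b = R `` {[Inr b]}"
      using inv_into_f_f[OF inj class_closed[OF inr_word[OF bB]]] by simp
    then show ?thesis using amalg_lift_inr[OF H h k _ bB] agree by simp
  qed
  ultimately show thesis by (rule that)
qed

lemma amalg_decomposition_generate:
  assumes G: "group G" and dec: "is_amalg_decomposition G A B C"
  shows "generate G (A \<union> B) = carrier G"
proof
  interpret G: group G by (rule G)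
  have sub: "subgroup A G" "subgroup B G" "subgroup C G" "C \<subseteq> A" "C \<subseteq> B"
    using dec by (simp_all add: is_amalg_decomposition_def)
  have AB: "A \<union> B \<subseteq> carrier G" using sub subgroup.subset by blast
  then show "generate G (A \<union> B) \<subseteq> carrier G" by (rule G.generate_incl)
  let ?A = "G\<lparr>carrier := A\<rparr>" and ?B = "G\<lparr>carrier := B\<rparr>" and ?C = "G\<lparr>carrier := C\<rparr>"
  interpret amalgam ?A ?B ?C "\<lambda>x. x" "\<lambda>x. x"
    using sub G.subgroup_imp_group by (intro amalgam.intro amalgam_axioms.intro) auto
  let ?\<theta> = "amalg_lift G (\<lambda>x. x) (\<lambda>x. x)"
  have incl: "(\<lambda>x. x) \<in> hom ?A G" "(\<lambda>x. x) \<in> hom ?B G"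
    using sub by (auto simp: hom_def dest: subgroup.mem_carrier)
  have iso: "?\<theta> \<in> iso P G" using dec by (simp add: is_amalg_decomposition_def)
  have eval: "amalg_eval G (\<lambda>x. x) (\<lambda>x. x) w \<in> generate G (A \<union> B)" if "w \<in> W" for w
    using that
  proof (induction w)
    case Nil
    then show ?case by (simp add: generate.one)
  next
    case (Cons x w)
    have "x \<in> A <+> B" using Cons.hyps(1) by simp
    then have "case_sum (\<lambda>x. x) (\<lambda>x. x) x \<in> A \<union> B" by auto
    then have "case_sum (\<lambda>x. x) (\<lambda>x. x) x \<in> generate G (A \<union> B)" by (rule generate.incl)
    then show ?case using Cons by (auto intro: generate.eng)
  qed
  show "carrier G \<subseteq> generate G (A \<union> B)"
  proof
    fix g assume "g \<in> carrier G"
    then obtain X where X: "X \<in> carrier P" "g = ?\<theta> X"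
      using iso by (auto simp: iso_def bij_betw_def)
    then obtain w where w: "w \<in> W" "X = R `` {w}" unfolding carrier_amalg by blast
    then have "g = amalg_eval G (\<lambda>x. x) (\<lambda>x. x) w"
      using X amalg_lift_class[OF G incl] by simp
    then show "g \<in> generate G (A \<union> B)" using eval w by simp
  qed
qed

text \<open>
  The semidirect product of the group of subsets of \<open>G\<close>, under symmetric difference, with \<open>G\<close> acting by
  left translation. Symmetric difference of the first set and the translated second one is written
  as inequality of the membership conditions.
\<close>

definition subset_semidirect :: "('a, 'm) monoid_scheme \<Rightarrow> ('a set \<times> 'a) monoid" where
  "subset_semidirect G =
     \<lparr>carrier = Pow (carrier G) \<times> carrier G,
      mult = (\<lambda>p q. ({x \<in> carrier G. (x \<in> fst p) \<noteq> (inv\<^bsub>G\<^esub> (snd p) \<otimes>\<^bsub>G\<^esub> x \<in> fst q)},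
                     snd p \<otimes>\<^bsub>G\<^esub> snd q)),
      one = ({}, \<one>\<^bsub>G\<^esub>)\<rparr>"

lemma group_subset_semidirect:
  fixes G (structure)
  assumes "group G"
  shows "group (subset_semidirect G)"
proof -
  interpret group G by (rule assms)
  show ?thesis
  proof (rule groupI)
    fix p q r
    assume "p \<in> carrier (subset_semidirect G)" "q \<in> carrier (subset_semidirect G)"
      "r \<in> carrier (subset_semidirect G)"
    then show "p \<otimes>\<^bsub>subset_semidirect G\<^esub> q \<otimes>\<^bsub>subset_semidirect G\<^esub> r =
      p \<otimes>\<^bsub>subset_semidirect G\<^esub> (q \<otimes>\<^bsub>subset_semidirect G\<^esub> r)"
      by (auto simp: subset_semidirect_def m_assoc inv_mult_group)
  next
    fix p assume p: "p \<in> carrier (subset_semidirect G)"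
    then show "\<one>\<^bsub>subset_semidirect G\<^esub> \<otimes>\<^bsub>subset_semidirect G\<^esub> p = p"
      by (cases p) (auto simp: subset_semidirect_def)
    define q where "q = ({x \<in> carrier G. snd p \<otimes> x \<in> fst p}, inv (snd p))"
    have "q \<in> carrier (subset_semidirect G)"
      using p by (auto simp: subset_semidirect_def q_def)
    moreover have "q \<otimes>\<^bsub>subset_semidirect G\<^esub> p = \<one>\<^bsub>subset_semidirect G\<^esub>"
      using p by (auto simp: subset_semidirect_def q_def)
    ultimately show "\<exists>q\<in>carrier (subset_semidirect G).
        q \<otimes>\<^bsub>subset_semidirect G\<^esub> p = \<one>\<^bsub>subset_semidirect G\<^esub>" by blast
  qed (auto simp: subset_semidirect_def)
qed

text \<open>
  Homomorphisms into the semidirect product that are the identity on the second component are the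
  derivations \<open>d (g h) = d g + g (d h)\<close>, where the sum is symmetric difference. The inner derivation
  on \<open>A\<close> given by \<open>C\<close> and the zero derivation on \<open>B\<close> agree on \<open>C\<close>, so the universal property merges them.
\<close>

lemma (in group) ex_derivation:
  assumes dec: "is_amalg_decomposition G A B C"
  obtains d where
    "\<And>g h x. g \<in> carrier G \<Longrightarrow> h \<in> carrier G \<Longrightarrow> x \<in> carrier G \<Longrightarrow>
       x \<in> d (g \<otimes> h) \<longleftrightarrow> (x \<in> d g) \<noteq> (inv g \<otimes> x \<in> d h)"
    "\<And>a x. a \<in> A \<Longrightarrow> x \<in> carrier G \<Longrightarrow> x \<in> d a \<longleftrightarrow> (x \<in> C) \<noteq> (inv a \<otimes> x \<in> C)"
    "\<And>b. b \<in> B \<Longrightarrow> d b = {}"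
proof -
  have sub: "subgroup A G" "subgroup B G" "subgroup C G" "C \<subseteq> A" "C \<subseteq> B"
    using dec by (simp_all add: is_amalg_decomposition_def)
  interpret A: subgroup A G by (rule sub)
  interpret B: subgroup B G by (rule sub)
  interpret C: subgroup C G by (rule sub)
  let ?H = "subset_semidirect G"
  define h where "h a = ({x \<in> carrier G. (x \<in> C) \<noteq> (inv a \<otimes> x \<in> C)}, a)" for a
  define k where "k b = ({} :: 'a set, b)" for b :: 'a
  have H: "group ?H" by (rule group_subset_semidirect) (rule is_group)
  have h: "h \<in> hom (G\<lparr>carrier := A\<rparr>) ?H"
    by (rule homI) (auto simp: h_def subset_semidirect_def inv_mult_group m_assoc)
  have k: "k \<in> hom (G\<lparr>carrier := B\<rparr>) ?H"
    by (rule homI) (auto simp: k_def subset_semidirect_def)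
  have agree: "h c = k c" if c: "c \<in> C" for c
  proof -
    have "inv c \<otimes> x \<in> C \<longleftrightarrow> x \<in> C" if x: "x \<in> carrier G" for x
    proof
      assume "inv c \<otimes> x \<in> C"
      then have "c \<otimes> (inv c \<otimes> x) \<in> C" using c by simp
      then show "x \<in> C" using c x by (simp add: cancel_left)
    qed (use c in simp)
    then show ?thesis by (auto simp: h_def k_def)
  qed
  obtain \<Phi> where \<Phi>: "\<Phi> \<in> hom G ?H" "\<And>a. a \<in> A \<Longrightarrow> \<Phi> a = h a" "\<And>b. b \<in> B \<Longrightarrow> \<Phi> b = k b"
    by (rule amalg_decomposition_extend[OF is_group dec H h k agree]) (auto intro: that)
  have mult: "\<Phi> (g \<otimes> g') = \<Phi> g \<otimes>\<^bsub>?H\<^esub> \<Phi> g'" if "g \<in> carrier G" "g' \<in> carrier G" for g g'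
    using hom_mult[OF \<Phi>(1) that] .
  have snd: "snd (\<Phi> g) = g" if "g \<in> carrier G" for g
    using sub(1,2) amalg_decomposition_generate[OF is_group dec] that
  proof (induction rule: generate_Un_induct)
    case one
    show ?case using \<Phi>(2)[of \<one>] by (simp add: h_def)
  next
    case (step g x)
    then have x: "x \<in> carrier G" by auto
    have "snd (\<Phi> x) = x" using step \<Phi>(2)[of x] \<Phi>(3)[of x] by (auto simp: h_def k_def)
    then show ?case using mult[OF step.hyps(1) x] step.IH by (simp add: subset_semidirect_def)
  qed
  show thesis
  proof (rule that[of "\<lambda>g. fst (\<Phi> g)"])
    fix g g' x assume "g \<in> carrier G" "g' \<in> carrier G" "x \<in> carrier G"
    then show "x \<in> fst (\<Phi> (g \<otimes> g')) \<longleftrightarrow> (x \<in> fst (\<Phi> g)) \<noteq> (inv g \<otimes> x \<in> fst (\<Phi> g'))"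
      by (simp add: mult subset_semidirect_def snd)
  qed (simp_all add: \<Phi>(2,3) h_def k_def)
qed

lemma (in group) ex_half_space:
  assumes dec: "is_amalg_decomposition G A B C"
  shows "\<exists>D. amalgam_half_space G A B C D"
proof -
  have sub: "subgroup A G" "subgroup B G" "subgroup C G" "C \<subseteq> A" "C \<subseteq> B"
    using dec by (simp_all add: is_amalg_decomposition_def)
  interpret A: subgroup A G by (rule sub)
  interpret B: subgroup B G by (rule sub)
  interpret C: subgroup C G by (rule sub)
  note gen = amalg_decomposition_generate[OF is_group dec]
  obtain d where
    d: "\<And>g h x. g \<in> carrier G \<Longrightarrow> h \<in> carrier G \<Longrightarrow> x \<in> carrier G \<Longrightarrow>
       x \<in> d (g \<otimes> h) \<longleftrightarrow> (x \<in> d g) \<noteq> (inv g \<otimes> x \<in> d h)"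
    and dA: "\<And>a x. a \<in> A \<Longrightarrow> x \<in> carrier G \<Longrightarrow> x \<in> d a \<longleftrightarrow> (x \<in> C) \<noteq> (inv a \<otimes> x \<in> C)"
    and dB: "\<And>b. b \<in> B \<Longrightarrow> d b = {}"
    by (rule ex_derivation[OF dec]) (rule that)
  have outside: "inv g \<otimes> x \<notin> C" if H: "subgroup H G" "C \<subseteq> H" and g: "g \<in> carrier G - H" and x: "x \<in> H"
    for H g x
  proof
    interpret H: subgroup H G by (rule H)
    assume "inv g \<otimes> x \<in> C"
    then have "inv (inv g \<otimes> x) \<in> H" using H(2) by (intro H.m_inv_closed) auto
    then have "x \<otimes> inv (inv g \<otimes> x) \<in> H" using x by simp
    then show False using g x by (simp add: inv_mult_group cancel_left)
  qed
  have dgb: "x \<in> d (g \<otimes> b) \<longleftrightarrow> x \<in> d g" if "g \<in> carrier G" "b \<in> B" "x \<in> carrier G" for g b x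
    using d that dB by simp
  have dga: "x \<in> d (g \<otimes> a) \<longleftrightarrow> x \<in> d g"
    if "g \<in> carrier G" "a \<in> A" "x \<in> carrier G" "inv g \<otimes> x \<notin> C" "inv (g \<otimes> a) \<otimes> x \<notin> C" for g a x
    using d dA that by (simp add: inv_mult_group m_assoc)
  have notH: "g \<otimes> h \<notin> H" if H: "subgroup H G" and "g \<in> carrier G - H" "h \<in> H" for g h H
  proof
    interpret H: subgroup H G by (rule H)
    assume "g \<otimes> h \<in> H"
    moreover have "inv h \<in> H" using that(3) by simp
    ultimately have "g \<otimes> h \<otimes> inv h \<in> H" by (rule H.m_closed)
    then show False using that(2,3) by (simp add: m_assoc)
  qed
  \<comment> \<open>A path that starts at the vertex \<open>B\<close> and avoids the base edge avoids all edges at the vertex \<open>A\<close>.\<close>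
  have star_A: "x \<notin> d g" if "g \<in> carrier G" "\<one> \<notin> d g" "x \<in> A" for g x
  proof -
    have inA: "x \<notin> d g" if "g \<in> A" "\<one> \<notin> d g" "x \<in> A" for g x
    proof -
      have "inv g \<in> C" using that dA[of g \<one>] by simp
      then have "inv g \<otimes> x \<in> C \<longleftrightarrow> x \<in> C"
      proof -
        have "inv g \<in> C" by fact
        then have gC: "g \<in> C" using that C.m_inv_closed[of "inv g"] by simp
        have "x \<in> C" if "inv g \<otimes> x \<in> C"
        proof -
          have "g \<otimes> (inv g \<otimes> x) \<in> C" using gC that by simp
          then show ?thesis using \<open>x \<in> A\<close> gC by (simp add: cancel_left)
        qed
        then show ?thesis using \<open>inv g \<in> C\<close> by auto
      qed
      then show ?thesis using dA[of g x] that by simp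
    qed
    have "\<one> \<notin> d g \<longrightarrow> (\<forall>x\<in>A. x \<notin> d g)" if "g \<in> carrier G"
      using sub(1,2) gen that
    proof (induction rule: generate_Un_induct)
      case one
      then show ?case using dB[of \<one>] by simp
    next
      case (step g y)
      show ?case
      proof (cases "y \<in> B")
        case True
        then show ?thesis using step dgb by simp
      next
        case False
        then have y: "y \<in> A" using step by simp
        show ?thesis
        proof (cases "g \<in> A")
          case True
          then show ?thesis using inA[of "g \<otimes> y"] y by simp
        next
          case False
          then have g: "g \<in> carrier G - A" "g \<otimes> y \<in> carrier G - A"
            using step.hyps(1) y notH[OF sub(1)] by simp_all
          then have "x \<in> d (g \<otimes> y) \<longleftrightarrow> x \<in> d g" if "x \<in> A" for x
            using dga[of g y x] outside[OF sub(1,4)] y that by simp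
          then show ?thesis using step.IH by simp
        qed
      qed
    qed
    then show ?thesis using that by simp
  qed
  \<comment> \<open>A path that starts at the vertex \<open>B\<close> contains at most one edge at \<open>B\<close>.\<close>
  have star_B: "b \<notin> d g" if "g \<in> carrier G" "\<one> \<in> d g" "b \<in> B - C" for g b
  proof -
    have "\<one> \<in> d g \<longrightarrow> b \<notin> d g" if b: "b \<in> B - C" and "g \<in> carrier G"
      using sub(1,2) gen that(2)
    proof (induction rule: generate_Un_induct)
      case one
      then show ?case using dB[of \<one>] by simp
    next
      case (step g y)
      show ?case
      proof (cases "y \<in> B \<or> g \<otimes> y \<in> B")
        case True
        then show ?thesis using step dgb b dB[of "g \<otimes> y"] by auto
      next
        case False
        then have y: "y \<in> A" and gy: "g \<otimes> y \<in> carrier G - B" using step by auto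
        show ?thesis
        proof (cases "g \<in> B")
          case True
          have iff: "x \<in> d (g \<otimes> y) \<longleftrightarrow> inv g \<otimes> x \<in> C" if "x \<in> B" for x
            using d[of g y x] dA[of y "inv g \<otimes> x"] dB[of g] outside[OF sub(2,5) gy that] True y that
            by (simp add: inv_mult_group m_assoc)
          have "\<not> (inv g \<in> C \<and> inv g \<otimes> b \<in> C)"
          proof
            assume *: "inv g \<in> C \<and> inv g \<otimes> b \<in> C"
            then have "inv (inv g) \<otimes> (inv g \<otimes> b) \<in> C" by blast
            then show False using True b by (simp add: cancel_left)
          qed
          then show ?thesis using iff[of \<one>] iff[of b] b True by auto
        next
          case False
          then have "g \<in> carrier G - B" using step by simp
          then have "x \<in> d (g \<otimes> y) \<longleftrightarrow> x \<in> d g" if "x \<in> B" for x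
            using dga[of g y x] outside[OF sub(2,5)] gy y that by simp
          then show ?thesis using step.IH b by simp
        qed
      qed
    qed
    then show ?thesis using that by simp
  qed
  define D where "D = {g \<in> carrier G. \<one> \<notin> d g}"
  have DA: "g \<in> C" if "g \<in> D" "g \<in> A" for g
  proof -
    have "inv g \<in> C" using that dA[of g \<one>] by (simp add: D_def)
    then show ?thesis using that C.m_inv_closed[of "inv g"] by simp
  qed
  have "amalgam_half_space G A B C D"
  proof
    show "generate G (A \<union> B) = carrier G" by (rule gen)
    show "C \<subseteq> D" using dB sub(5) by (auto simp: D_def)
  next
    fix g b assume "g \<in> D" "b \<in> B"
    then show "g \<otimes> b \<in> D" using dgb[of g b \<one>] by (simp add: D_def)
  next
    fix g a assume g: "g \<in> D - C" and a: "a \<in> A"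
    then have gA: "g \<in> carrier G - A" using DA[of g] by (auto simp: D_def)
    then have gaA: "g \<otimes> a \<in> carrier G - A" using a notH[OF sub(1)] by simp
    have "\<one> \<notin> d (g \<otimes> a)"
      using dga[of g a \<one>] gA gaA a g outside[OF sub(1,4) gA A.one_closed]
        outside[OF sub(1,4) gaA A.one_closed] by (simp add: D_def)
    then show "g \<otimes> a \<in> D - C" using gaA sub(4) by (auto simp: D_def)
  next
    fix a g assume a: "a \<in> A - C" and g: "g \<in> D"
    have "inv a \<notin> C" using a C.m_inv_closed[of "inv a"] by (metis A.mem_carrier DiffD1 DiffD2 inv_inv)
    then have "\<one> \<in> d a" using a dA[of a \<one>] by simp
    moreover have "inv a \<notin> d g" using star_A[of g "inv a"] g a by (simp add: D_def)
    ultimately show "a \<otimes> g \<notin> D" using d[of a g \<one>] a g by (simp add: D_def)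
  next
    fix b g assume b: "b \<in> B - C" and g: "g \<in> carrier G - D"
    have "inv b \<notin> C" using b C.m_inv_closed[of "inv b"] by (metis B.mem_carrier DiffD1 DiffD2 inv_inv)
    then have "inv b \<notin> d g" using star_B[of g "inv b"] g b by (simp add: D_def)
    then have "\<one> \<notin> d (b \<otimes> g)" using d[of b g \<one>] dB[of b] b g by simp
    then have "b \<otimes> g \<in> D" using b g by (simp add: D_def)
    moreover have "b \<otimes> g \<notin> C"
    proof
      assume "b \<otimes> g \<in> C"
      then have "b \<otimes> g \<in> B" using sub(5) by auto
      moreover have "inv b \<in> B" using b by simp
      ultimately have "inv b \<otimes> (b \<otimes> g) \<in> B" by (rule B.m_closed[rotated])
      then have "g \<in> B" using b g by (simp add: cancel_left)
      then show False using g dB by (simp add: D_def)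
    qed
    ultimately show "b \<otimes> g \<in> D - C" by simp
  qed (simp_all add: sub D_def)
  then show ?thesis by blast
qed

section \<open>Normal subgroups of amalgamated products\<close>

theorem theorem2p1:
  fixes G :: "('a, 'm) monoid_scheme" and N A B C :: "'a set"
  assumes "group G"
    and "N \<lhd> G"
    and "is_nontrivial_amalg_decomposition G A B C"
  shows
    "(finitely_generated_subgroup G N \<and> \<not> N \<subseteq> C \<longrightarrow>
        finite_index G (N <#>\<^bsub>G\<^esub> C) \<and>
        (finitely_generated_subgroup G (N \<inter> C) \<longrightarrow>
           finitely_generated_subgroup G (N \<inter> A) \<and> finitely_generated_subgroup G (N \<inter> B))) \<and>
     (finite_index G (N <#>\<^bsub>G\<^esub> C) \<longrightarrow>
        \<not> N \<subseteq> C \<and>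
        (finitely_generated_subgroup G (N \<inter> A) \<and> finitely_generated_subgroup G (N \<inter> B) \<longrightarrow>
           finitely_generated_subgroup G N)) \<and>
     (finite_index G (N <#>\<^bsub>G\<^esub> C) \<longrightarrow>
        (finite (carrier (G Mod N)) \<longleftrightarrow>
         finite (carrier ((G\<lparr>carrier := C\<rparr>) Mod (N \<inter> C)))))"
proof -
  interpret group G by (rule assms(1))
  interpret N: normal N G by (rule assms(2))
  have dec: "is_amalg_decomposition G A B C" and neA: "A \<noteq> C" and neB: "C \<noteq> B"
    using assms(3) by (simp_all add: is_nontrivial_amalg_decomposition_def)
  obtain D where D: "amalgam_half_space G A B C D" using ex_half_space[OF dec] by blast
  interpret amalgam_half_space G A B C D by (rule D)
  interpret swapped: amalgam_half_space G B A C "C \<union> (carrier G - D)" by (rule swap)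
  have 1: "finite_index G (N <#>\<^bsub>G\<^esub> C) \<and> (finitely_generated_subgroup G (N \<inter> C) \<longrightarrow>
      finitely_generated_subgroup G (N \<inter> A) \<and> finitely_generated_subgroup G (N \<inter> B))"
    if "finitely_generated_subgroup G N" "\<not> N \<subseteq> C"
  proof -
    have "finite_index G (N <#>\<^bsub>G\<^esub> C)"
      by (rule finite_index_of_finitely_generated[OF assms(2) that neA neB])
    then show ?thesis
      using finitely_generated_inter_A[OF assms(2) that(1)]
        swapped.finitely_generated_inter_A[OF assms(2) that(1)] by simp
  qed
  have 2: "\<not> N \<subseteq> C" if fin: "finite_index G (N <#>\<^bsub>G\<^esub> C)"
  proof
    assume "N \<subseteq> C"
    have "N <#>\<^bsub>G\<^esub> C = C"
    proof
      show "N <#>\<^bsub>G\<^esub> C \<subseteq> C" using \<open>N \<subseteq> C\<close> by (auto simp: set_mult_def)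
      show "C \<subseteq> N <#>\<^bsub>G\<^esub> C"
      proof
        fix c assume "c \<in> C"
        moreover from this have "c = \<one>\<^bsub>G\<^esub> \<otimes>\<^bsub>G\<^esub> c" by simp
        ultimately show "c \<in> N <#>\<^bsub>G\<^esub> C" unfolding set_mult_def using N.one_closed by blast
      qed
    qed
    then show False using not_finite_index_C[OF neA neB] fin by simp
  qed
  have 3: "finitely_generated_subgroup G N"
    if "finite_index G (N <#>\<^bsub>G\<^esub> C)" "finitely_generated_subgroup G (N \<inter> A)"
      "finitely_generated_subgroup G (N \<inter> B)"
    by (rule finitely_generated_of_factors[OF assms(2) subA subB subC CA swapped.CA gen that])
  show ?thesis using 1 2 3 finite_quotient_iff[OF assms(2) subC] by blast
qed

end
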